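(* Let $M=(m_{ij})$ be a homogeneous, well-ordered $2\times 2$ matrix of integers, of degree $d>0$. A general homogeneous form $F$ of degree $d$ in $\mathbb{C}[x_0,x_1,x_2]$ is the determinant of a $2\times 2$ matrix of forms whose degree matrix is $M$ if and only if either $m_{11}\in\{0,d\}$, or $m_{21}\geq 0$.
   Context: A $2\times 2$ integer matrix $\begin{pmatrix} a&b\\ c&e\end{pmatrix}$ is homogeneous if $a+e=b+c$; its degree is $d=a+e=b+c$. It is well-ordered if entries are non-increasing going leftward and downward, i.e. $m_{21}\leq m_{11}\leq m_{12}$ and $m_{21}\le m_{22}\le m_{12}$. A matrix of forms $(f_{ij})$ has degree matrix $(m_{ij})$ if each $f_{ij}$ is a homogeneous polynomial of degree $m_{ij}$ (the zero polynomial allowed; necessarily $f_{ij}=0$ if $m_{ij}<0$). "A general form of degree $d$" means all forms in a nonempty Zariski-open subset of the space of degree-$d$ forms. *)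

theory Defs
  imports Complex_Main "HOL-Library.Poly_Mapping"
begin

text \<open>Polynomials in the variables x_0, x_1, x_2 over the complex numbers, represented
  as finitely supported maps from monomials (exponent vectors, nat to nat finitely
  supported) to coefficients; ring operations come from HOL-Library.Poly_Mapping.
  Only monomials in the variables 0, 1, 2 are allowed in forms.\<close>

type_synonym monom = "nat \<Rightarrow>\<^sub>0 nat"
type_synonym cpoly = "monom \<Rightarrow>\<^sub>0 complex"

definition mon_deg :: "monom \<Rightarrow> nat" where
  "mon_deg \<mu> = (\<Sum>i\<in>Poly_Mapping.keys \<mu>. Poly_Mapping.lookup \<mu> i)"

text \<open>F is a form (homogeneous polynomial, zero allowed) of degree m in C[x_0,x_1,x_2].
  For m < 0 only the zero polynomial qualifies.\<close>
definition is_form :: "int \<Rightarrow> cpoly \<Rightarrow> bool" where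
  "is_form m F \<longleftrightarrow> (\<forall>\<mu>\<in>Poly_Mapping.keys F. Poly_Mapping.keys \<mu> \<subseteq> {0,1,2} \<and> int (mon_deg \<mu>) = m)"

definition forms :: "int \<Rightarrow> cpoly set" where
  "forms m = {F. is_form m F}"

inductive_set poly_fun :: "(cpoly \<Rightarrow> complex) set" where
  pf_const: "(\<lambda>F. c) \<in> poly_fun"
| pf_coeff: "(\<lambda>F. Poly_Mapping.lookup F \<mu>) \<in> poly_fun"
| pf_add: "p \<in> poly_fun \<Longrightarrow> q \<in> poly_fun \<Longrightarrow> (\<lambda>F. p F + q F) \<in> poly_fun"
| pf_mult: "p \<in> poly_fun \<Longrightarrow> q \<in> poly_fun \<Longrightarrow> (\<lambda>F. p F * q F) \<in> poly_fun"

definition zariski_open_forms :: "int \<Rightarrow> cpoly set \<Rightarrow> bool" where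
  "zariski_open_forms d U \<longleftrightarrow>
     (\<exists>S \<subseteq> poly_fun. U = {F \<in> forms d. \<exists>p\<in>S. p F \<noteq> 0})"

definition general_form :: "int \<Rightarrow> (cpoly \<Rightarrow> bool) \<Rightarrow> bool" where
  "general_form d P \<longleftrightarrow> (\<exists>U. zariski_open_forms d U \<and> U \<noteq> {} \<and> (\<forall>F\<in>U. P F))"

text \<open>Degree matrix given as (m11 m12; m21 m22) = (a b; c e).\<close>
definition homogeneous_mat :: "int \<Rightarrow> int \<Rightarrow> int \<Rightarrow> int \<Rightarrow> bool" where
  "homogeneous_mat a b c e \<longleftrightarrow> a + e = b + c"

definition well_ordered_mat :: "int \<Rightarrow> int \<Rightarrow> int \<Rightarrow> int \<Rightarrow> bool" where
  "well_ordered_mat a b c e \<longleftrightarrow> c \<le> a \<and> a \<le> b \<and> c \<le> e \<and> e \<le> b"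

definition is_det_degmat :: "int \<Rightarrow> int \<Rightarrow> int \<Rightarrow> int \<Rightarrow> cpoly \<Rightarrow> bool" where
  "is_det_degmat a b c e F \<longleftrightarrow>
     (\<exists>f11 f12 f21 f22. is_form a f11 \<and> is_form b f12 \<and> is_form c f21 \<and> is_form e f22
        \<and> F = f11 * f22 - f12 * f21)"

end

theory Submission
  imports Defs "HOL-Computational_Algebra.Fundamental_Theorem_Algebra"
begin

text \<open>The set of determinants in degree \<open>d\<close> is the image of a polynomial map, hence constructible by
  quantifier elimination; so it either contains a nonempty Zariski-open set or misses one. The second
  alternative is excluded for \<open>c \<ge> 0\<close> because the differential of the determinant map is surjective
  at the matrix with entries \<open>x\<^sub>0\<^sup>a\<close>, \<open>G\<close>, \<open>x\<^sub>2\<^sup>c\<close>, \<open>x\<^sub>1\<^sup>e\<close> (listed by rows) for a suitable form \<open>G\<close>,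
  i.e. these four forms generate all forms of degree \<open>d\<close>. If \<open>c < 0\<close>, then every determinant is a
  product of forms of degrees \<open>a\<close> and \<open>e\<close>; by compactness such products are closed under
  coefficientwise limits, so if they contained a nonempty Zariski-open set, then
  \<open>x\<^sub>0\<^sup>d + x\<^sub>1\<^bsup>d-1\<^esup> x\<^sub>2\<close> would be one, which forces \<open>a \<in> {0, d}\<close>.\<close>

section \<open>Quantifier elimination for constructible sets\<close>

text \<open>A surjective differential shows only that no polynomial function vanishes on all
  determinants without vanishing on all forms, that is, density of the image. The statement asks for
  an open set inside the image, and constructibility bridges this gap.

  The spanning claim lives in the quotient by x_0^a, x_1^e, x_2^c, a monomial complete intersection
  with socle degree a + e + c - 3. There, multiplication by \<open>G\<close> from degree c onto
  degree a + e is dual to an injection from degree c - 3 into degree a + e - 3; hence the index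
  range i + j + 3 \<le> c in the linear system. All monomials of \<open>G\<close> have the same
  difference of exponents of x_0 and x_1, so the system splits along diagonals, and the weights
  \<open>q ^ k\<^sup>2\<close> make every diagonal block dominant without any determinant being
  evaluated.

  For negative c, compactness stands in for a dimension count: a single form that is no product
  suffices, even if it lies outside the given open set, since a line through it meets that set in
  points arbitrarily close to it.\<close>

locale fun_ring =
  fixes A :: "('s \<Rightarrow> complex) set"
  assumes const: "(\<lambda>_. c) \<in> A"
    and add: "p \<in> A \<Longrightarrow> q \<in> A \<Longrightarrow> (\<lambda>v. p v + q v) \<in> A"
    and mult: "p \<in> A \<Longrightarrow> q \<in> A \<Longrightarrow> (\<lambda>v. p v * q v) \<in> A"
begin

lemma uminus: "p \<in> A \<Longrightarrow> (\<lambda>v. - p v) \<in> A"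
  using mult[OF const[of "-1"]] by simp

lemma diff: "p \<in> A \<Longrightarrow> q \<in> A \<Longrightarrow> (\<lambda>v. p v - q v) \<in> A"
  using add[OF _ uminus] by simp

lemma sum: "(\<And>i. i \<in> I \<Longrightarrow> p i \<in> A) \<Longrightarrow> (\<lambda>v. \<Sum>i\<in>I. p i v) \<in> A"
  by (induction I rule: infinite_finite_induct) (auto intro: const add)

inductive_set constr :: "'s set set" where
  zero: "p \<in> A \<Longrightarrow> {v. p v = 0} \<in> constr"
| compl: "X \<in> constr \<Longrightarrow> - X \<in> constr"
| inter: "X \<in> constr \<Longrightarrow> Y \<in> constr \<Longrightarrow> X \<inter> Y \<in> constr"

lemma constr_UNIV: "UNIV \<in> constr"
  using zero[OF const[of 0]] by simp

lemma constr_union: "X \<in> constr \<Longrightarrow> Y \<in> constr \<Longrightarrow> X \<union> Y \<in> constr"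
  using compl[OF inter[OF compl compl], of X Y] by simp

lemma constr_INT:
  "finite I \<Longrightarrow> (\<And>i. i \<in> I \<Longrightarrow> p i \<in> A) \<Longrightarrow> {v. \<forall>i\<in>I. p i v = 0} \<in> constr"
proof (induction I rule: finite_induct)
  case empty
  then show ?case using constr_UNIV by simp
next
  case (insert i I)
  have "{v. \<forall>j\<in>insert i I. p j v = 0} = {v. p i v = 0} \<inter> {v. \<forall>j\<in>I. p j v = 0}" by auto
  then show ?case using insert by (auto intro!: inter zero)
qed

text \<open>Elimination over parameters branches on whether a leading coefficient \<open>c\<close>
  vanishes; this glues the two branches.\<close>

lemma constr_cases:
  assumes "c \<in> A" "X0 \<in> constr" "X1 \<in> constr"
    and "\<And>v. c v = 0 \<Longrightarrow> v \<in> X \<longleftrightarrow> v \<in> X0" "\<And>v. c v \<noteq> 0 \<Longrightarrow> v \<in> X \<longleftrightarrow> v \<in> X1"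
  shows "X \<in> constr"
proof -
  have "X = ({v. c v = 0} \<inter> X0) \<union> (- {v. c v = 0} \<inter> X1)"
    using assms(4,5) by auto
  then show ?thesis using assms(1-3) by (auto intro!: constr_union inter compl zero)
qed

text \<open>Polynomials with coefficients in \<open>A\<close>; only a bound on the degree is fixed, since the
  formal leading coefficient may vanish at some points.\<close>

definition pps :: "nat \<Rightarrow> ('s \<Rightarrow> complex poly) set" where
  "pps n = {P. (\<forall>i. (\<lambda>v. coeff (P v) i) \<in> A) \<and> (\<forall>v. \<forall>i\<ge>n. coeff (P v) i = 0)}"

lemma pps_coeff: "P \<in> pps n \<Longrightarrow> (\<lambda>v. coeff (P v) i) \<in> A"
  by (simp add: pps_def)

lemma pps_bound: "P \<in> pps n \<Longrightarrow> i \<ge> n \<Longrightarrow> coeff (P v) i = 0"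
  by (simp add: pps_def)

lemma ppsI:
  "(\<And>i. (\<lambda>v. coeff (P v) i) \<in> A) \<Longrightarrow> (\<And>v i. i \<ge> n \<Longrightarrow> coeff (P v) i = 0) \<Longrightarrow> P \<in> pps n"
  by (simp add: pps_def)

lemma pps_add: "P \<in> pps m \<Longrightarrow> Q \<in> pps n \<Longrightarrow> (\<lambda>v. P v + Q v) \<in> pps (max m n)"
  by (rule ppsI) (auto intro: add pps_coeff simp: pps_bound)

lemma pps_diff: "P \<in> pps n \<Longrightarrow> Q \<in> pps n \<Longrightarrow> (\<lambda>v. P v - Q v) \<in> pps n"
  by (rule ppsI) (auto intro: diff pps_coeff simp: pps_bound)

lemma pps_monom: "c \<in> A \<Longrightarrow> k < n \<Longrightarrow> (\<lambda>v. monom (c v) k) \<in> pps n"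
proof (rule ppsI)
  fix i assume "c \<in> A"
  then show "(\<lambda>v. coeff (monom (c v) k) i) \<in> A"
    by (cases "i = k") (auto intro: const)
qed auto

lemma pps_mult:
  assumes "P \<in> pps m" "Q \<in> pps n" shows "(\<lambda>v. P v * Q v) \<in> pps (m + n)"
proof (rule ppsI)
  fix i show "(\<lambda>v. coeff (P v * Q v) i) \<in> A"
    unfolding coeff_mult using assms by (intro sum mult pps_coeff)
next
  fix v i assume i: "i \<ge> m + n"
  have "coeff (P v) j * coeff (Q v) (i - j) = 0" for j
    using pps_bound[OF assms(1), of j v] pps_bound[OF assms(2), of "i - j" v] i
    by (cases "j \<ge> m") auto
  then show "coeff (P v * Q v) i = 0" unfolding coeff_mult by (intro sum.neutral) blast
qed

lemma pps_power: "P \<in> pps m \<Longrightarrow> \<exists>n. (\<lambda>v. P v ^ k) \<in> pps n"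
proof (induction k)
  case 0
  have "(\<lambda>v. monom 1 0) \<in> pps 1" by (intro pps_monom const) simp
  then show ?case by (auto simp: monom_eq_1)
next
  case (Suc k)
  then obtain n where "(\<lambda>v. P v ^ k) \<in> pps n" by blast
  then show ?case using pps_mult[OF Suc.prems] by (auto intro: exI[of _ "m + n"])
qed

lemma pps_lower:
  assumes "P \<in> pps (Suc n)" "\<And>v. coeff (P v) n = 0" shows "P \<in> pps n"
proof (rule ppsI)
  fix v i assume "i \<ge> n"
  then show "coeff (P v) i = 0"
    using pps_bound[OF assms(1), of i v] assms(2)[of v] by (cases "i = n") auto
qed (rule pps_coeff[OF assms(1)])

text \<open>\<open>A\<close> is only a ring, so the top term of \<open>Q\<close> is cancelled by
  cross-multiplication instead of division.\<close>

lemma pps_pseudo_step: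
  assumes P: "P \<in> pps (Suc n)" and Q: "Q \<in> pps (Suc m)" and "n \<le> m"
  shows "(\<lambda>v. smult (coeff (P v) n) (Q v) - monom (coeff (Q v) m) (m - n) * P v) \<in> pps m"
proof (rule pps_lower, rule ppsI)
  fix i
  have *: "coeff (monom a k * p) i = (if k \<le> i then a * coeff p (i - k) else 0)"
    for a :: complex and k p by (simp add: coeff_monom_mult)
  show "(\<lambda>v. coeff (smult (coeff (P v) n) (Q v) - monom (coeff (Q v) m) (m - n) * P v) i) \<in> A"
    unfolding coeff_diff coeff_smult *
    by (cases "m - n \<le> i") (auto intro!: diff mult pps_coeff[OF P] pps_coeff[OF Q])
next
  fix v i assume "Suc m \<le> i"
  then show "coeff (smult (coeff (P v) n) (Q v) - monom (coeff (Q v) m) (m - n) * P v) i = 0"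
    using pps_bound[OF P, of "i - (m - n)" v] pps_bound[OF Q, of i v] \<open>n \<le> m\<close>
    by (auto simp: coeff_monom_mult)
next
  fix v
  show "coeff (smult (coeff (P v) n) (Q v) - monom (coeff (Q v) m) (m - n) * P v) m = 0"
    using \<open>n \<le> m\<close> by (auto simp: coeff_monom_mult)
qed

lemma pps_zero_constr:
  assumes "Q \<in> pps m" shows "{v. Q v = 0} \<in> constr"
proof -
  have "{v. Q v = 0} = {v. \<forall>i\<in>{..<m}. coeff (Q v) i = 0}"
    by (auto simp: poly_eq_iff) (metis pps_bound[OF assms] lessThan_iff not_le)
  then show ?thesis using constr_INT[of "{..<m}" "\<lambda>i v. coeff (Q v) i"] pps_coeff[OF assms] by auto
qed

lemma degree_pps:
  assumes "P \<in> pps (Suc n)" "coeff (P v) n \<noteq> 0" shows "degree (P v) = n"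
  by (rule antisym) (use assms pps_bound[OF assms(1)] in \<open>auto intro!: degree_le le_degree\<close>)

text \<open>Where the leading coefficient of \<open>P\<close> is nonzero, a pseudo-division step
  preserves divisibility by \<open>P\<close> in both directions. Once the degree of \<open>Q\<close>
  is forced below \<open>n\<close>, divisibility just means \<open>Q v = 0\<close>.\<close>

lemma dvd_constr:
  assumes P: "P \<in> pps (Suc n)" and "Q \<in> pps m"
  shows "\<exists>X\<in>constr. \<forall>v. coeff (P v) n \<noteq> 0 \<longrightarrow> (v \<in> X \<longleftrightarrow> P v dvd Q v)"
  using assms(2)
proof (induction m arbitrary: Q)
  case 0
  then have "Q v = 0" for v using pps_bound[of Q 0] by (simp add: poly_eq_iff)
  then show ?case using constr_UNIV by auto
next
  case (Suc m)
  show ?case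
  proof (cases "n \<le> m")
    case True
    let ?R = "\<lambda>v. smult (coeff (P v) n) (Q v) - monom (coeff (Q v) m) (m - n) * P v"
    obtain X where X: "X \<in> constr" "\<forall>v. coeff (P v) n \<noteq> 0 \<longrightarrow> (v \<in> X \<longleftrightarrow> P v dvd ?R v)"
      using Suc.IH[OF pps_pseudo_step[OF P Suc.prems True]] by blast
    have "P v dvd ?R v \<longleftrightarrow> P v dvd Q v" if "coeff (P v) n \<noteq> 0" for v
    proof -
      have "P v dvd a - b * P v \<longleftrightarrow> P v dvd a" for a b
        using dvd_diff[of "P v" a "b * P v"] dvd_add[of "P v" "a - b * P v" "b * P v"] by auto
      then show ?thesis using that by (simp add: dvd_smult_iff)
    qed
    then show ?thesis using X by blast
  next
    case False
    have "P v dvd Q v \<longleftrightarrow> Q v = 0" if "coeff (P v) n \<noteq> 0" for v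
    proof
      assume d: "P v dvd Q v"
      show "Q v = 0"
      proof (rule ccontr)
        assume "Q v \<noteq> 0"
        then have "n \<le> degree (Q v)" using dvd_imp_degree_le[OF d] degree_pps[OF P that] by simp
        moreover have "degree (Q v) \<le> m"
          by (rule degree_le) (use pps_bound[OF Suc.prems] in auto)
        ultimately show False using False by simp
      qed
    qed auto
    then show ?thesis using pps_zero_constr[OF Suc.prems] by (intro bexI[of _ "{v. Q v = 0}"]) auto
  qed
qed

text \<open>A Euclidean algorithm with parameters: splitting on leading coefficients and
  pseudo-division shrink the list until at most one equation is left. The \<open>Suc\<close> in the
  measure makes it drop also when an equation with bound 0, which is identically zero, is
  discarded.\<close>

lemma ex_root_constr:
  assumes "\<forall>(n, P)\<in>set L. P \<in> pps n" and Q: "Q \<in> pps m"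
  shows "{v. \<exists>t. (\<forall>(n, P)\<in>set L. poly (P v) t = 0) \<and> poly (Q v) t \<noteq> 0} \<in> constr"
  using assms(1)
proof (induction "sum_list (map (Suc \<circ> fst) L)" arbitrary: L rule: less_induct)
  case less
  let ?E = "\<lambda>L. {v. \<exists>t. (\<forall>(n, P)\<in>set L. poly (P v) t = 0) \<and> poly (Q v) t \<noteq> 0}"
  have drop_lead: "(\<lambda>v. P v - monom (coeff (P v) n) n) \<in> pps n" if "P \<in> pps (Suc n)" for P n
    by (rule pps_lower, rule pps_diff[OF that], rule pps_monom) (auto intro: pps_coeff[OF that])
  consider "L = []" | P where "(0, P) \<in> set L" | n P where "L = [(Suc n, P)]"
    | n1 P1 n2 P2 L' where "set L = set ((Suc n1, P1) # (Suc n2, P2) # L')" "n1 \<le> n2"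
      "sum_list (map (Suc \<circ> fst) L) = sum_list (map (Suc \<circ> fst) ((Suc n1, P1) # (Suc n2, P2) # L'))"
  proof (cases "L = [] \<or> (\<exists>P. (0, P) \<in> set L)")
    case True
    then show ?thesis using that by blast
  next
    case False
    then obtain x L1 where L: "L = x # L1" by (cases L) auto
    have "fst x \<noteq> 0" using False L by (cases x) auto
    then obtain n P where x: "x = (Suc n, P)" by (cases x) (auto simp: gr0_conv_Suc)
    show ?thesis
    proof (cases L1)
      case Nil
      then show ?thesis using that L x by blast
    next
      case (Cons y L')
      have "fst y \<noteq> 0" using False L Cons by (cases y) auto
      then obtain n' P' where y: "y = (Suc n', P')" by (cases y) (auto simp: gr0_conv_Suc)
      show ?thesis
      proof (cases "n \<le> n'")
        case True
        then show ?thesis using that(4)[of n P n' P' L'] L Cons x y by auto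
      next
        case False
        then show ?thesis using that(4)[of n' P' n P L'] L Cons x y by (auto simp: insert_commute)
      qed
    qed
  qed
  then show ?case
  proof cases
    case 1
    have "?E L = - {v. Q v = 0}"
      unfolding 1 by (auto simp: poly_all_0_iff_0[symmetric])
    then show ?thesis using pps_zero_constr[OF Q] by (auto intro: compl)
  next
    case (2 P)
    let ?L = "remove1 (0, P) L"
    have P0: "P v = 0" for v using less.prems 2 pps_bound[of P 0] by (auto simp: poly_eq_iff)
    have sets: "set L = insert (0, P) (set ?L)"
      using 2 set_remove1_subset[of "(0, P)" L] in_set_remove1[of _ "(0, P)" L] by blast
    have "?E L = ?E ?L" using P0 unfolding sets by auto
    moreover have "sum_list (map (Suc \<circ> fst) ?L) < sum_list (map (Suc \<circ> fst) L)"
      using sum_list_map_remove1[OF 2, of "Suc \<circ> fst"] by simp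
    moreover have "\<forall>(n, P)\<in>set ?L. P \<in> pps n" using less.prems sets by auto
    ultimately show ?thesis using less.hyps by simp
  next
    case (3 n P)
    have P: "P \<in> pps (Suc n)" using less.prems 3 by auto
    \<comment> \<open>\<open>n\<close> is the degree of \<open>P v\<close> where the leading
      coefficient is nonzero, hence bounds the multiplicity of its roots: \<open>Q v\<close>
      vanishes at all of them iff \<open>P v dvd Q v ^ n\<close>.\<close>
    obtain k where k: "(\<lambda>v. Q v ^ n) \<in> pps k" using pps_power[OF Q] by blast
    obtain X where X: "X \<in> constr" "\<forall>v. coeff (P v) n \<noteq> 0 \<longrightarrow> (v \<in> X \<longleftrightarrow> P v dvd Q v ^ n)"
      using dvd_constr[OF P k] by blast
    let ?L = "[(n, \<lambda>v. P v - monom (coeff (P v) n) n)]"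
    have "?E ?L \<in> constr" by (rule less.hyps) (use 3 drop_lead[OF P] in auto)
    then show ?thesis
    proof (rule constr_cases[OF pps_coeff[OF P, of n] _ compl[OF X(1)]])
      fix v assume nz: "coeff (P v) n \<noteq> 0"
      then have "degree (P v) = n" "P v \<noteq> 0" using degree_pps[OF P] by auto
      then show "v \<in> ?E L \<longleftrightarrow> v \<in> - X"
        using nullstellensatz_univariate[of "P v" "Q v"] X(2) nz unfolding 3 by auto
    qed (auto simp: 3)
  next
    case (4 n1 P1 n2 P2 L')
    have P: "P1 \<in> pps (Suc n1)" "P2 \<in> pps (Suc n2)" using less.prems 4(1) by auto
    have L': "\<forall>(n, P)\<in>set L'. P \<in> pps n" using less.prems 4(1) by auto
    let ?R1 = "\<lambda>v. P1 v - monom (coeff (P1 v) n1) n1"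
    let ?R2 = "\<lambda>v. smult (coeff (P1 v) n1) (P2 v) - monom (coeff (P2 v) n2) (n2 - n1) * P1 v"
    let ?L1 = "(n1, ?R1) # (Suc n2, P2) # L'"
    let ?L2 = "(Suc n1, P1) # (n2, ?R2) # L'"
    have "?E ?L1 \<in> constr" by (rule less.hyps) (use 4(3) L' P drop_lead[OF P(1)] in auto)
    moreover have "?E ?L2 \<in> constr"
      by (rule less.hyps) (use 4(3) L' P pps_pseudo_step[OF P 4(2)] in auto)
    ultimately show ?thesis
    proof (rule constr_cases[OF pps_coeff[OF P(1), of n1]])
      fix v assume "coeff (P1 v) n1 = 0"
      then show "v \<in> ?E L \<longleftrightarrow> v \<in> ?E ?L1" using 4(1) by auto
    next
      fix v assume "coeff (P1 v) n1 \<noteq> 0"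
      then have "poly (P1 v) t = 0 \<and> poly (P2 v) t = 0 \<longleftrightarrow> poly (P1 v) t = 0 \<and> poly (?R2 v) t = 0" for t
        by (cases "poly (P1 v) t = 0") simp_all
      moreover have "(\<forall>(n, P)\<in>set L. poly (P v) t = 0) \<longleftrightarrow>
        (poly (P1 v) t = 0 \<and> poly (P2 v) t = 0) \<and> (\<forall>(n, P)\<in>set L'. poly (P v) t = 0)" for t
        unfolding 4(1) by simp
      moreover have "(\<forall>(n, P)\<in>set ?L2. poly (P v) t = 0) \<longleftrightarrow>
        (poly (P1 v) t = 0 \<and> poly (?R2 v) t = 0) \<and> (\<forall>(n, P)\<in>set L'. poly (P v) t = 0)" for t
        by simp
      ultimately show "v \<in> ?E L \<longleftrightarrow> v \<in> ?E ?L2" by simp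
    qed
  qed
qed

text \<open>An existential quantifier commutes with unions but not with complements, so projection
  works on this normal form. One inequation per cell suffices because inequations can be multiplied
  together.\<close>

inductive_set dnf :: "'s set set" where
  cell: "finite S \<Longrightarrow> S \<subseteq> A \<Longrightarrow> q \<in> A \<Longrightarrow> {v. (\<forall>p\<in>S. p v = 0) \<and> q v \<noteq> 0} \<in> dnf"
| union: "X \<in> dnf \<Longrightarrow> Y \<in> dnf \<Longrightarrow> X \<union> Y \<in> dnf"

lemma dnf_inter: "X \<in> dnf \<Longrightarrow> Y \<in> dnf \<Longrightarrow> X \<inter> Y \<in> dnf"
proof (induction X rule: dnf.induct)
  case (cell S q)
  from cell(4,1-3) show ?case
  proof (induction Y rule: dnf.induct)
    case (cell S' q')
    have "{v. (\<forall>p\<in>S. p v = 0) \<and> q v \<noteq> 0} \<inter> {v. (\<forall>p\<in>S'. p v = 0) \<and> q' v \<noteq> 0} =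
      {v. (\<forall>p\<in>S \<union> S'. p v = 0) \<and> q v * q' v \<noteq> 0}" by auto
    then show ?case using dnf.cell[of "S \<union> S'" "\<lambda>v. q v * q' v"] cell mult by auto
  qed (auto simp: Int_Un_distrib intro: dnf.union)
qed (auto simp: Int_Un_distrib2 intro: dnf.union)

lemma constr_dnf: "X \<in> constr \<Longrightarrow> X \<in> dnf \<and> - X \<in> dnf"
proof (induction rule: constr.induct)
  case (zero p)
  then show ?case using dnf.cell[of "{p}" "\<lambda>_. 1"] dnf.cell[of "{}" p] const
    by (auto simp: Collect_neg_eq)
qed (auto simp: dnf_inter intro: dnf.union)

end

section \<open>Polynomial functions in coordinates and projections of constructible sets\<close>

inductive_set pfun :: "(('v \<Rightarrow> complex) \<Rightarrow> complex) set" where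
  const: "(\<lambda>v. c) \<in> pfun"
| var: "(\<lambda>v. v x) \<in> pfun"
| add: "p \<in> pfun \<Longrightarrow> q \<in> pfun \<Longrightarrow> (\<lambda>v. p v + q v) \<in> pfun"
| mult: "p \<in> pfun \<Longrightarrow> q \<in> pfun \<Longrightarrow> (\<lambda>v. p v * q v) \<in> pfun"

interpretation pf: fun_ring pfun
  by standard (auto intro: pfun.intros)

lemma pfun_pps:
  "p \<in> pfun \<Longrightarrow> \<exists>n P. P \<in> pf.pps n \<and> (\<forall>v t. p (v(x := t)) = poly (P v) t)"
proof (induction rule: pfun.induct)
  case (const c)
  show ?case
    by (rule exI[of _ 1], rule exI[of _ "\<lambda>v. monom c 0"])
      (auto intro!: pf.pps_monom pfun.const simp: poly_monom)
next
  case (var y)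
  show ?case
  proof (cases "y = x")
    case True
    then show ?thesis
      by (intro exI[of _ 2] exI[of _ "\<lambda>v. monom 1 1"])
        (auto intro!: pf.pps_monom pfun.const simp: poly_monom)
  next
    case False
    then show ?thesis
      by (intro exI[of _ 1] exI[of _ "\<lambda>v. monom (v y) 0"])
        (auto intro!: pf.pps_monom pfun.var simp: poly_monom)
  qed
next
  case (add p q)
  then show ?case using pf.pps_add by (metis poly_add)
next
  case (mult p q)
  then show ?case using pf.pps_mult by (metis poly_mult)
qed

text \<open>Chevalley's theorem for one coordinate: on a cell, the condition on \<open>t\<close> is
  a system of univariate equations and one inequation, with the other coordinates as
  parameters.\<close>

lemma constr_ex_var:
  assumes "X \<in> pf.constr" shows "{v. \<exists>t. v(x := t) \<in> X} \<in> pf.constr"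
proof -
  have "X \<in> pf.dnf" using pf.constr_dnf[OF assms] by blast
  then show ?thesis
  proof (induction rule: pf.dnf.induct)
    case (cell S q)
    obtain N P where P: "\<And>p. p \<in> S \<Longrightarrow> P p \<in> pf.pps (N p)"
      "\<And>p v t. p \<in> S \<Longrightarrow> p (v(x := t)) = poly (P p v) t"
      using pfun_pps[of _ x] cell(2) by (metis (no_types, lifting) subsetD)
    obtain m Q where Q: "Q \<in> pf.pps m" "\<And>v t. q (v(x := t)) = poly (Q v) t"
      using pfun_pps[OF cell(3)] by blast
    obtain l where l: "set l = S" using cell(1) finite_list by blast
    have "{v. \<exists>t. (\<forall>(n, P)\<in>set (map (\<lambda>p. (N p, P p)) l). poly (P v) t = 0) \<and> poly (Q v) t \<noteq> 0}
      \<in> pf.constr"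
      by (rule pf.ex_root_constr[OF _ Q(1)]) (use P(1) l in auto)
    also have "{v. \<exists>t. (\<forall>(n, P)\<in>set (map (\<lambda>p. (N p, P p)) l). poly (P v) t = 0) \<and> poly (Q v) t \<noteq> 0}
      = {v. \<exists>t. v(x := t) \<in> {v. (\<forall>p\<in>S. p v = 0) \<and> q v \<noteq> 0}}"
      using P(2) Q(2) l by auto
    finally show ?case .
  next
    case (union X Y)
    have eq: "{v. \<exists>t. v(x := t) \<in> X \<union> Y} = {v. \<exists>t. v(x := t) \<in> X} \<union> {v. \<exists>t. v(x := t) \<in> Y}" by auto
    show ?case unfolding eq by (rule pf.constr_union[OF union.IH])
  qed
qed

lemma constr_ex_vars:
  assumes "finite V" "X \<in> pf.constr"
  shows "{v. \<exists>w\<in>X. \<forall>y. y \<notin> V \<longrightarrow> w y = v y} \<in> pf.constr"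
  using assms
proof (induction V rule: finite_induct)
  case empty
  have "{v. \<exists>w\<in>X. \<forall>y. y \<notin> {} \<longrightarrow> w y = v y} = X" by (auto simp: fun_eq_iff[symmetric])
  then show ?case using empty by simp
next
  case (insert x V)
  let ?Y = "{v. \<exists>w\<in>X. \<forall>y. y \<notin> V \<longrightarrow> w y = v y}"
  have "{v. \<exists>w\<in>X. \<forall>y. y \<notin> insert x V \<longrightarrow> w y = v y} = {v. \<exists>t. v(x := t) \<in> ?Y}"
  proof (intro set_eqI iffI)
    fix v assume "v \<in> {v. \<exists>w\<in>X. \<forall>y. y \<notin> insert x V \<longrightarrow> w y = v y}"
    then obtain w where "w \<in> X" "\<forall>y. y \<notin> insert x V \<longrightarrow> w y = v y" by auto
    then have "v(x := w x) \<in> ?Y" by auto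
    then show "v \<in> {v. \<exists>t. v(x := t) \<in> ?Y}" by blast
  next
    fix v assume "v \<in> {v. \<exists>t. v(x := t) \<in> ?Y}"
    then obtain t w where w: "w \<in> X" "\<forall>y. y \<notin> V \<longrightarrow> w y = (v(x := t)) y" by blast
    then have "\<forall>y. y \<notin> insert x V \<longrightarrow> w y = v y" by simp
    then show "v \<in> {v. \<exists>w\<in>X. \<forall>y. y \<notin> insert x V \<longrightarrow> w y = v y}" using w(1) by blast
  qed
  then show ?case using constr_ex_var[OF insert.IH[OF insert.prems]] by simp
qed

section \<open>Irreducibility of affine space\<close>

lemma pfun_line: "p \<in> pfun \<Longrightarrow> \<exists>P. \<forall>t. p (\<lambda>i. v i + t * (w i - v i)) = poly P t"
proof (induction rule: pfun.induct)
  case (const c)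
  show ?case by (rule exI[of _ "[:c:]"]) simp
next
  case (var x)
  show ?case by (rule exI[of _ "[:v x, w x - v x:]"]) simp
next
  case (add p q)
  then obtain P Q where "\<forall>t. p (\<lambda>i. v i + t * (w i - v i)) = poly P t"
    "\<forall>t. q (\<lambda>i. v i + t * (w i - v i)) = poly Q t" by blast
  then show ?case by (intro exI[of _ "P + Q"]) simp
next
  case (mult p q)
  then obtain P Q where "\<forall>t. p (\<lambda>i. v i + t * (w i - v i)) = poly P t"
    "\<forall>t. q (\<lambda>i. v i + t * (w i - v i)) = poly Q t" by blast
  then show ?case by (intro exI[of _ "P * Q"]) simp
qed

text \<open>On the line joining \<open>v\<close> and \<open>w\<close> both functions become nonzero
  univariate polynomials, so their product has a non-root.\<close>

lemma pfun_mult_nonzero: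
  assumes "f \<in> pfun" "g \<in> pfun" "f v \<noteq> 0" "g w \<noteq> 0"
  shows "\<exists>u. f u * g u \<noteq> 0"
proof -
  obtain P Q where P: "\<forall>t. f (\<lambda>i. v i + t * (w i - v i)) = poly P t"
    and Q: "\<forall>t. g (\<lambda>i. v i + t * (w i - v i)) = poly Q t"
    using pfun_line assms(1,2) by metis
  have "poly P 0 \<noteq> 0" "poly Q 1 \<noteq> 0" using P[rule_format, of 0] Q[rule_format, of 1] assms by auto
  then have "P * Q \<noteq> 0" by auto
  then obtain t where "poly (P * Q) t \<noteq> 0" using poly_all_0_iff_0 by blast
  then show ?thesis using P Q by (metis poly_mult)
qed

text \<open>Only intersections need an argument: the two open sets supplied by induction must meet,
  which is \<open>pfun_mult_nonzero\<close>.\<close>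

lemma constr_dichotomy:
  "X \<in> pf.constr \<Longrightarrow> \<exists>f\<in>pfun. (\<exists>v. f v \<noteq> 0) \<and> ({v. f v \<noteq> 0} \<subseteq> X \<or> {v. f v \<noteq> 0} \<inter> X = {})"
proof (induction rule: pf.constr.induct)
  case (zero p)
  show ?case
  proof (cases "\<exists>v. p v \<noteq> 0")
    case True
    then show ?thesis using zero by (intro bexI[of _ p]) auto
  next
    case False
    then show ?thesis by (intro bexI[of _ "\<lambda>_. 1"]) (auto intro: pfun.const)
  qed
next
  case (compl X)
  then show ?case by (metis Compl_disjoint2 disjoint_eq_subset_Compl double_complement)
next
  case (inter X Y)
  then obtain f g where f: "f \<in> pfun" "\<exists>v. f v \<noteq> 0" "{v. f v \<noteq> 0} \<subseteq> X \<or> {v. f v \<noteq> 0} \<inter> X = {}"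
    and g: "g \<in> pfun" "\<exists>v. g v \<noteq> 0" "{v. g v \<noteq> 0} \<subseteq> Y \<or> {v. g v \<noteq> 0} \<inter> Y = {}" by blast
  have "(\<lambda>v. f v * g v) \<in> pfun" "\<exists>v. f v * g v \<noteq> 0"
    using f g pfun_mult_nonzero by (auto intro: pfun.mult)
  moreover have "{v. f v * g v \<noteq> 0} \<subseteq> X \<inter> Y \<or> {v. f v * g v \<noteq> 0} \<inter> (X \<inter> Y) = {}"
    using f(3) g(3) by auto
  ultimately show ?case by (intro bexI[of _ "\<lambda>v. f v * g v"]) auto
qed

section \<open>Forms and the surjectivity of the differential\<close>

abbreviation coef :: "cpoly \<Rightarrow> monom \<Rightarrow> complex" where
  "coef \<equiv> Poly_Mapping.lookup"

abbreviation C :: "complex \<Rightarrow> cpoly" where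
  "C \<equiv> Poly_Mapping.single 0"

definition mon3 :: "nat \<Rightarrow> nat \<Rightarrow> nat \<Rightarrow> monom" where
  "mon3 i j k = Poly_Mapping.single 0 i + Poly_Mapping.single 1 j + Poly_Mapping.single 2 k"

definition monoms :: "int \<Rightarrow> monom set" where
  "monoms m = {\<mu>. Poly_Mapping.keys \<mu> \<subseteq> {0,1,2} \<and> int (mon_deg \<mu>) = m}"

lemma is_form_iff: "is_form m F \<longleftrightarrow> Poly_Mapping.keys F \<subseteq> monoms m"
  by (auto simp: is_form_def monoms_def)

lemma lookup_mon3:
  "Poly_Mapping.lookup (mon3 i j k) n = (if n = 0 then i else if n = 1 then j else if n = 2 then k else 0)"
  by (simp add: mon3_def lookup_add lookup_single when_def)

lemma mon3_add: "mon3 i j k + mon3 i' j' k' = mon3 (i + i') (j + j') (k + k')"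
  by (rule poly_mapping_eqI) (simp add: lookup_add lookup_mon3)

lemma mon3_inject [simp]: "mon3 i j k = mon3 i' j' k' \<longleftrightarrow> i = i' \<and> j = j' \<and> k = k'"
proof
  assume "mon3 i j k = mon3 i' j' k'"
  then have "Poly_Mapping.lookup (mon3 i j k) n = Poly_Mapping.lookup (mon3 i' j' k') n" for n by simp
  from this[of 0] this[of 1] this[of 2] show "i = i' \<and> j = j' \<and> k = k'" by (simp add: lookup_mon3)
qed auto

lemma mon3_0: "mon3 0 0 0 = 0"
  by (simp add: mon3_def)

lemma mon_deg_3:
  assumes "Poly_Mapping.keys \<mu> \<subseteq> {0,1,2}"
  shows "mon_deg \<mu> = Poly_Mapping.lookup \<mu> 0 + Poly_Mapping.lookup \<mu> 1 + Poly_Mapping.lookup \<mu> 2"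
proof -
  have "mon_deg \<mu> = (\<Sum>i\<in>{0,1,2}. Poly_Mapping.lookup \<mu> i)"
    unfolding mon_deg_def by (rule sum.mono_neutral_left) (use assms in \<open>auto simp: in_keys_iff\<close>)
  then show ?thesis by simp
qed

lemma keys_mon3: "Poly_Mapping.keys (mon3 i j k) \<subseteq> {0,1,2}"
  by (auto simp: in_keys_iff lookup_mon3 split: if_splits)

lemma monoms_iff: "\<mu> \<in> monoms m \<longleftrightarrow> (\<exists>i j k. \<mu> = mon3 i j k \<and> int (i + j + k) = m)"
proof
  assume \<mu>: "\<mu> \<in> monoms m"
  then have keys: "Poly_Mapping.keys \<mu> \<subseteq> {0,1,2}" by (simp add: monoms_def)
  let ?l = "Poly_Mapping.lookup \<mu>"
  have "?l n = 0" if "n \<notin> {0,1,2}" for n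
    using keys that by (metis in_keys_iff subsetD)
  then have "\<mu> = mon3 (?l 0) (?l 1) (?l 2)"
    by (intro poly_mapping_eqI) (simp add: lookup_mon3)
  then show "\<exists>i j k. \<mu> = mon3 i j k \<and> int (i + j + k) = m"
    using \<mu> mon_deg_3[OF keys] by (auto simp: monoms_def)
next
  assume "\<exists>i j k. \<mu> = mon3 i j k \<and> int (i + j + k) = m"
  then obtain i j k where \<mu>: "\<mu> = mon3 i j k" "int (i + j + k) = m" by blast
  then show "\<mu> \<in> monoms m"
    using mon_deg_3[OF keys_mon3[of i j k]] keys_mon3[of i j k] by (simp add: monoms_def lookup_mon3)
qed

lemma mon3_in_monoms [simp]: "mon3 i j k \<in> monoms m \<longleftrightarrow> int (i + j + k) = m"
  by (auto simp: monoms_iff)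

lemma finite_monoms: "finite (monoms m)"
proof (rule finite_subset)
  show "monoms m \<subseteq> (\<lambda>(i, j, k). mon3 i j k) ` ({..nat m} \<times> {..nat m} \<times> {..nat m})"
  proof
    fix \<mu> assume "\<mu> \<in> monoms m"
    then obtain i j k where "\<mu> = mon3 i j k" "int (i + j + k) = m" by (auto simp: monoms_iff)
    then show "\<mu> \<in> (\<lambda>(i, j, k). mon3 i j k) ` ({..nat m} \<times> {..nat m} \<times> {..nat m})"
      by (intro image_eqI[of _ _ "(i, j, k)"]) auto
  qed
qed auto

lemma monoms_add: "\<mu> \<in> monoms m \<Longrightarrow> \<nu> \<in> monoms n \<Longrightarrow> \<mu> + \<nu> \<in> monoms (m + n)"
  by (auto simp: monoms_iff mon3_add)

lemma is_form_neg: "is_form m F \<Longrightarrow> m < 0 \<Longrightarrow> F = 0"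
  by (auto simp: is_form_def)

lemma is_form_coef: "is_form m F \<Longrightarrow> \<mu> \<notin> monoms m \<Longrightarrow> coef F \<mu> = 0"
  by (auto simp: is_form_iff in_keys_iff)

lemma is_formI: "(\<And>\<mu>. \<mu> \<notin> monoms m \<Longrightarrow> coef F \<mu> = 0) \<Longrightarrow> is_form m F"
  by (auto simp: is_form_iff in_keys_iff)

lemma is_form_0: "is_form m 0"
  by (simp add: is_form_def)

lemma is_form_add: "is_form m F \<Longrightarrow> is_form m G \<Longrightarrow> is_form m (F + G)"
  by (rule is_formI) (simp add: lookup_add is_form_coef)

lemma is_form_diff: "is_form m F \<Longrightarrow> is_form m G \<Longrightarrow> is_form m (F - G)"
  by (rule is_formI) (simp add: lookup_minus is_form_coef)

lemma is_form_sum: "(\<And>i. i \<in> I \<Longrightarrow> is_form m (F i)) \<Longrightarrow> is_form m (\<Sum>i\<in>I. F i)"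
  by (induction I rule: infinite_finite_induct) (auto intro: is_form_add is_form_0)

lemma is_form_single: "\<mu> \<in> monoms m \<Longrightarrow> is_form m (Poly_Mapping.single \<mu> c)"
  by (rule is_formI) (auto simp: lookup_single when_def)

lemma is_form_mult: "is_form m F \<Longrightarrow> is_form n G \<Longrightarrow> is_form (m + n) (F * G)"
  unfolding is_form_iff using keys_mult[of F G] monoms_add by blast

lemma is_form_C_mult: "is_form m F \<Longrightarrow> is_form m (C c * F)"
  using is_form_mult[OF is_form_single[of 0 0 c]] mon3_in_monoms[of 0 0 0 0] by (simp add: mon3_0)

lemma coef_C_mult [simp]: "coef (C c * F) \<mu> = c * coef F \<mu>"
  unfolding mult_map_scale_conv_mult[symmetric] by (simp add: map.rep_eq when_def)

lemma sum_single_coef: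
  assumes "is_form m F" shows "F = (\<Sum>\<mu>\<in>monoms m. Poly_Mapping.single \<mu> (coef F \<mu>))"
  by (rule poly_mapping_eqI)
    (auto simp: lookup_sum lookup_single when_def sum.delta finite_monoms is_form_coef[OF assms])

lemma coef_mult_forms:
  assumes "is_form m F" "is_form n G"
  shows "coef (F * G) \<mu> =
    (\<Sum>\<alpha>\<in>monoms m. \<Sum>\<beta>\<in>monoms n. if \<alpha> + \<beta> = \<mu> then coef F \<alpha> * coef G \<beta> else 0)"
  by (subst sum_single_coef[OF assms(1)], subst sum_single_coef[OF assms(2)])
    (simp add: sum_product mult_single lookup_sum lookup_single when_def)

section \<open>Linear functionals on polynomials\<close>

interpretation cp: vector_space "\<lambda>c F. C c * F"
  by standard (auto simp: distrib_left distrib_right single_add mult_single mult.assoc[symmetric])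

interpretation cf: vector_space "\<lambda>c x :: complex. c * x"
  by standard (auto simp: distrib_left distrib_right)

interpretation cpf: vector_space_pair "\<lambda>c F. C c * F" "\<lambda>c x :: complex. c * x" ..

text \<open>Membership in \<open>W\<close> can thus be proved by duality: a vector outside
  \<open>W\<close> would be detected by a functional that kills \<open>W\<close>.\<close>

lemma functional_separating:
  assumes "cp.subspace W" "x \<notin> W"
  obtains g where "\<And>F G. g (F + G) = g F + g G" "\<And>c F. g (C c * F) = c * g F"
    "\<And>F. F \<in> W \<Longrightarrow> g F = (0 :: complex)" "g x = 1"
proof -
  obtain B where B: "B \<subseteq> W" "\<not> cp.dependent B" "W \<subseteq> cp.span B"
    using cp.maximal_independent_subset[of W] by blast
  have spanB: "cp.span B = W" using B assms(1) cp.span_subspace by blast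
  then have "\<not> cp.dependent (insert x B)"
    using B(2) assms(2) cp.independent_insertI by blast
  then obtain g where g: "Vector_Spaces.linear (\<lambda>c F. C c * F) (\<lambda>c x. c * x) g"
    "\<forall>y\<in>insert x B. g y = (if y = x then 1 else (0 :: complex))"
    using cpf.linear_independent_extend[of "insert x B" "\<lambda>y. if y = x then 1 else 0"] by blast
  have "x \<notin> B" using B(1) assms(2) by blast
  then have "g F = 0" if "F \<in> W" for F
    using cpf.linear_eq_0_on_span[OF g(1), of B F] g(2) that spanB by force
  then show thesis using that g cpf.linear_add[OF g(1)] cpf.linear_scale[OF g(1)] by auto
qed

text \<open>Along a diagonal \<open>i - j = const\<close> the system is Hankel with entries \<open>q powi k\<^sup>2\<close>. Choosing
  \<open>\<kappa>\<close> as the pivot index for every row, the rescaling by \<open>q powi (2 * \<kappa> * s)\<close> turns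
  the entries into \<open>q powi (k - \<kappa>)\<^sup>2\<close>, which is diagonally dominant for small \<open>q\<close>.\<close>

lemma hankel_kernel_trivial:
  fixes z :: "int \<Rightarrow> int \<Rightarrow> complex" and q :: real
  assumes q: "0 < q" "q * card K < 1" "q \<le> 1" and K: "finite K"
    and supp: "\<And>i j. z i j \<noteq> 0 \<Longrightarrow> 0 \<le> i \<and> 0 \<le> j \<and> i + j + 3 \<le> c"
    and K_mem: "\<And>k. c \<le> 2 * k + 2 \<Longrightarrow> k + 2 \<le> c \<Longrightarrow> k \<in> K"
    and eq: "\<And>u0 u1. 0 \<le> u0 \<Longrightarrow> 0 \<le> u1 \<Longrightarrow> u0 + u1 \<le> c \<Longrightarrow>
      (\<Sum>k\<in>K. of_real (q powi k\<^sup>2) * z (k - u0) (k - u1)) = 0"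
  shows "z i0 j0 = 0"
proof (rule ccontr)
  assume nz: "z i0 j0 \<noteq> 0"
  \<comment> \<open>The value depends only on the difference of the indices, so it is the same along
    the whole diagonal. The inequalities \<open>k1\<close> below put it into \<open>K\<close> and
    make \<open>u0 = \<kappa> - i\<close>, \<open>u1 = \<kappa> - j\<close> an admissible row, whose
    term at \<open>\<kappa>\<close> is \<open>z i j\<close>.\<close>
  define \<kappa> where "\<kappa> = (c + \<bar>i0 - j0\<bar>) div 2"
  define f where "f s = norm (z (i0 + s) (j0 + s)) * q powi (2 * \<kappa> * s)" for s
  define S where "S = {s. z (i0 + s) (j0 + s) \<noteq> 0}"
  have "S \<subseteq> {- i0..c - i0}" using supp by (fastforce simp: S_def)
  then have "finite S" by (rule finite_subset) simp
  moreover have "S \<noteq> {}" using nz by (auto simp: S_def intro: exI[of _ 0])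
  ultimately have "Max (f ` S) \<in> f ` S" by simp
  then obtain s where s: "s \<in> S" "Max (f ` S) = f s" by blast
  have s_max: "f s' \<le> f s" if "s' \<in> S" for s'
    unfolding s(2)[symmetric] using \<open>finite S\<close> that by simp
  have f_nonneg: "0 \<le> f s'" for s' unfolding f_def using q by (simp add: power_int_def)
  have f_le: "f s' \<le> f s" for s'
    using s_max[of s'] f_nonneg[of s] by (cases "s' \<in> S") (auto simp: S_def f_def)
  define i where "i = i0 + s"
  define j where "j = j0 + s"
  have zij: "z i j \<noteq> 0" using s(1) by (simp add: S_def i_def j_def)
  have ij: "0 \<le> i" "0 \<le> j" "i + j + 3 \<le> c" using supp[OF zij] by auto
  have \<kappa>: "\<kappa> = (c + \<bar>i - j\<bar>) div 2" by (simp add: \<kappa>_def i_def j_def)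
  have k1: "i \<le> \<kappa>" "j \<le> \<kappa>" "2 * \<kappa> \<le> c + i + j" "\<kappa> + 2 \<le> c" "c \<le> 2 * \<kappa> + 2"
    using ij unfolding \<kappa> by linarith+
  have "\<kappa> \<in> K" using K_mem k1 by blast
  have shift: "norm (z (i + t) (j + t)) * q powi (2 * \<kappa> * t) \<le> norm (z i j)" for t
  proof -
    have "norm (z (i + t) (j + t)) * q powi (2 * \<kappa> * t) * q powi (2 * \<kappa> * s) = f (s + t)"
      using q by (simp add: f_def i_def j_def power_int_add algebra_simps)
    also have "\<dots> \<le> norm (z i j) * q powi (2 * \<kappa> * s)"
      using f_le by (simp add: f_def i_def j_def)
    finally show ?thesis using q by (simp add: mult_le_cancel_right)
  qed
  \<comment> \<open>With k = \<kappa> + t the exponent is \<kappa>^2 + t^2 + 2 \<kappa> t. The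
    weight in \<open>f\<close> absorbs the cross term through \<open>shift\<close>, and t^2 \<ge> 1
    leaves a spare factor \<open>q\<close>, which pays for the number of terms.\<close>
  have bound: "norm (of_real (q powi k\<^sup>2) * z (k - (\<kappa> - i)) (k - (\<kappa> - j))) \<le> q powi \<kappa>\<^sup>2 * (q * norm (z i j))"
    if "k \<noteq> \<kappa>" for k
  proof -
    define t where "t = k - \<kappa>"
    have t: "t \<noteq> 0" "k\<^sup>2 = \<kappa>\<^sup>2 + t\<^sup>2 + 2 * \<kappa> * t"
      using that by (auto simp: t_def power2_eq_square algebra_simps)
    then have "1 \<le> t\<^sup>2" by (simp add: zero_less_power2 int_one_le_iff_zero_less)
    then have "q powi t\<^sup>2 \<le> q"
      using power_int_decreasing[of 1 "t\<^sup>2" q] q by simp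
    moreover have "q powi k\<^sup>2 = q powi \<kappa>\<^sup>2 * q powi t\<^sup>2 * q powi (2 * \<kappa> * t)"
      unfolding t(2) using q by (simp add: power_int_add)
    moreover have "k - (\<kappa> - i) = i + t" "k - (\<kappa> - j) = j + t" by (simp_all add: t_def)
    moreover have "norm (of_real (q powi k\<^sup>2) * w) = q powi k\<^sup>2 * norm w" for w :: complex
      by (simp only: norm_mult norm_of_real abs_of_pos[OF zero_less_power_int[OF q(1)]])
    ultimately have "norm (of_real (q powi k\<^sup>2) * z (k - (\<kappa> - i)) (k - (\<kappa> - j)))
      = q powi \<kappa>\<^sup>2 * (q powi t\<^sup>2 * (norm (z (i + t) (j + t)) * q powi (2 * \<kappa> * t)))"
      by (simp only: mult.assoc mult.left_commute mult.commute)
    also have "\<dots> \<le> q powi \<kappa>\<^sup>2 * (q * norm (z i j))"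
      using shift[of t] q \<open>q powi t\<^sup>2 \<le> q\<close> by (intro mult_left_mono mult_mono) auto
    finally show ?thesis .
  qed
  have "(\<Sum>k\<in>K. of_real (q powi k\<^sup>2) * z (k - (\<kappa> - i)) (k - (\<kappa> - j))) = 0"
    using k1 by (intro eq) auto
  then have "of_real (q powi \<kappa>\<^sup>2) * z i j =
    - (\<Sum>k\<in>K - {\<kappa>}. of_real (q powi k\<^sup>2) * z (k - (\<kappa> - i)) (k - (\<kappa> - j)))"
    using sum.remove[OF K \<open>\<kappa> \<in> K\<close>, of "\<lambda>k. of_real (q powi k\<^sup>2) * z (k - (\<kappa> - i)) (k - (\<kappa> - j))"]
    by (simp add: eq_neg_iff_add_eq_0)
  then have "norm (of_real (q powi \<kappa>\<^sup>2) * z i j) =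
    norm (\<Sum>k\<in>K - {\<kappa>}. of_real (q powi k\<^sup>2) * z (k - (\<kappa> - i)) (k - (\<kappa> - j)))" by simp
  also have "\<dots> \<le> (\<Sum>k\<in>K - {\<kappa>}. q powi \<kappa>\<^sup>2 * (q * norm (z i j)))"
    by (rule sum_norm_le) (use bound in blast)
  also have "\<dots> \<le> real (card K) * (q powi \<kappa>\<^sup>2 * (q * norm (z i j)))"
    using q card_mono[OF K, of "K - {\<kappa>}"] by (auto intro!: mult_right_mono)
  also have "\<dots> = (q powi \<kappa>\<^sup>2 * norm (z i j)) * (q * card K)" by simp
  also have "\<dots> < (q powi \<kappa>\<^sup>2 * norm (z i j)) * 1"
    using q zij by (intro mult_strict_left_mono) auto
  finally show False
    by (simp only: norm_mult norm_of_real abs_of_pos[OF zero_less_power_int[OF q(1)]] mult_1_right less_irrefl)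
qed

text \<open>Modulo \<open>x\<^sub>0\<^sup>a\<close>, \<open>x\<^sub>1\<^sup>e\<close> and \<open>x\<^sub>2\<^sup>c\<close>, multiplying \<open>gform a e c\<close> by monomials of degree \<open>c\<close>
  yields, in the coordinates \<open>(i, j)\<close> of the monomials \<open>x\<^sub>0\<^bsup>a-1-i\<^esup> x\<^sub>1\<^bsup>e-1-j\<^esup> x\<^sub>2\<^bsup>2+i+j\<^esup>\<close>,
  the system of \<open>hankel_kernel_trivial\<close> with \<open>q = 1 / (a + 1)\<close>.\<close>

definition gform_idx :: "nat \<Rightarrow> nat \<Rightarrow> nat \<Rightarrow> nat set" where
  "gform_idx a e c = {k. k < a \<and> k < e \<and> c \<le> 2 * k + 2}"

definition gform :: "nat \<Rightarrow> nat \<Rightarrow> nat \<Rightarrow> cpoly" where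
  "gform a e c = (\<Sum>k\<in>gform_idx a e c.
     Poly_Mapping.single (mon3 (a - 1 - k) (e - 1 - k) (2 * k + 2 - c)) (of_real ((1 / (real a + 1)) ^ k\<^sup>2)))"

lemma is_form_gform: "is_form (int a + int e - int c) (gform a e c)"
  unfolding gform_def by (intro is_form_sum is_form_single) (auto simp: gform_idx_def)

text \<open>By duality it suffices that a functional \<open>g\<close> killing \<open>W\<close> kills
  all monomials of degree a + e. It vanishes on multiples of the three pure powers, and being zero
  on monomial multiples of \<open>gform a e c\<close> puts its other values into the kernel of the
  Hankel system.\<close>

lemma forms_spanned:
  fixes a e c :: nat
  assumes ce: "c \<le> a" "c \<le> e" and F: "is_form (int a + int e) F"
  shows "\<exists>u w y t. is_form (int e) u \<and> is_form (int a) w \<and> is_form (int a + int e - int c) y \<and>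
    is_form (int c) t \<and> F = Poly_Mapping.single (mon3 a 0 0) 1 * u + Poly_Mapping.single (mon3 0 e 0) 1 * w +
      Poly_Mapping.single (mon3 0 0 c) 1 * y + gform a e c * t"
proof -
  let ?X = "Poly_Mapping.single (mon3 a 0 0) 1 :: cpoly" and ?Y = "Poly_Mapping.single (mon3 0 e 0) 1 :: cpoly"
    and ?Z = "Poly_Mapping.single (mon3 0 0 c) 1 :: cpoly"
  define W where "W = {?X * u + ?Y * w + ?Z * y + gform a e c * t | u w y t. is_form (int e) u \<and>
    is_form (int a) w \<and> is_form (int a + int e - int c) y \<and> is_form (int c) t}"
  have WI: "?X * u + ?Y * w + ?Z * y + gform a e c * t \<in> W"
    if "is_form (int e) u" "is_form (int a) w" "is_form (int a + int e - int c) y" "is_form (int c) t"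
    for u w y t using that unfolding W_def by blast
  have sub: "cp.subspace W"
    unfolding cp.subspace_def
  proof (intro conjI ballI allI)
    show "0 \<in> W" using WI[of 0 0 0 0] by (simp add: is_form_0)
  next
    fix x x' assume "x \<in> W" "x' \<in> W"
    then obtain u w y t u' w' y' t' where
      "is_form (int e) u" "is_form (int a) w" "is_form (int a + int e - int c) y" "is_form (int c) t"
      "is_form (int e) u'" "is_form (int a) w'" "is_form (int a + int e - int c) y'" "is_form (int c) t'"
      and x: "x = ?X * u + ?Y * w + ?Z * y + gform a e c * t" "x' = ?X * u' + ?Y * w' + ?Z * y' + gform a e c * t'"
      unfolding W_def by blast
    then have "?X * (u + u') + ?Y * (w + w') + ?Z * (y + y') + gform a e c * (t + t') \<in> W"
      by (intro WI is_form_add)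
    then show "x + x' \<in> W" unfolding x by (simp add: algebra_simps)
  next
    fix r x assume "x \<in> W"
    then obtain u w y t where
      "is_form (int e) u" "is_form (int a) w" "is_form (int a + int e - int c) y" "is_form (int c) t"
      and x: "x = ?X * u + ?Y * w + ?Z * y + gform a e c * t"
      unfolding W_def by blast
    then have "?X * (C r * u) + ?Y * (C r * w) + ?Z * (C r * y) + gform a e c * (C r * t) \<in> W"
      by (intro WI is_form_C_mult)
    then show "C r * x \<in> W" unfolding x by (simp add: distrib_left mult.left_commute)
  qed
  have mon_W: "Poly_Mapping.single (mon3 i j k) 1 \<in> W" if ijk: "i + j + k = a + e" for i j k
  proof (rule ccontr)
    assume "Poly_Mapping.single (mon3 i j k) 1 \<notin> W"
    then obtain g where g: "\<And>F G. g (F + G) = g F + g G" "\<And>r F. g (C r * F) = r * g F"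
      "\<And>F. F \<in> W \<Longrightarrow> g F = (0 :: complex)" "g (Poly_Mapping.single (mon3 i j k) 1) = 1"
      using functional_separating[OF sub] by blast
    define v where "v i j k = g (Poly_Mapping.single (mon3 i j k) 1)" for i j k
    have g_sum: "g (\<Sum>i\<in>I. h i) = (\<Sum>i\<in>I. g (h i))" if "finite I" for I :: "nat set" and h
      using that g(2)[of 0 0] by (induction I rule: finite_induct) (auto simp: g(1))
    have v0: "v i j k = 0" if "i + j + k = a + e" "a \<le> i \<or> e \<le> j \<or> c \<le> k" for i j k
      using that(2)
    proof (elim disjE)
      assume "a \<le> i"
      then have "Poly_Mapping.single (mon3 i j k) 1 = ?X * Poly_Mapping.single (mon3 (i - a) j k) 1 + ?Y * 0 + ?Z * 0 + gform a e c * 0"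
        by (simp add: mult_single mon3_add)
      also have "\<dots> \<in> W" by (intro WI is_form_0 is_form_single) (use that(1) \<open>a \<le> i\<close> in auto)
      finally show ?thesis using g(3) by (simp add: v_def)
    next
      assume "e \<le> j"
      then have "Poly_Mapping.single (mon3 i j k) 1 = ?X * 0 + ?Y * Poly_Mapping.single (mon3 i (j - e) k) 1 + ?Z * 0 + gform a e c * 0"
        by (simp add: mult_single mon3_add)
      also have "\<dots> \<in> W" by (intro WI is_form_0 is_form_single) (use that(1) \<open>e \<le> j\<close> in auto)
      finally show ?thesis using g(3) by (simp add: v_def)
    next
      assume "c \<le> k"
      then have "Poly_Mapping.single (mon3 i j k) 1 = ?X * 0 + ?Y * 0 + ?Z * Poly_Mapping.single (mon3 i j (k - c)) 1 + gform a e c * 0"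
        by (simp add: mult_single mon3_add)
      also have "\<dots> \<in> W" by (intro WI is_form_0 is_form_single) (use that(1) \<open>c \<le> k\<close> in auto)
      finally show ?thesis using g(3) by (simp add: v_def)
    qed
    \<comment> \<open>There are at most \<open>a\<close> indices in \<open>gform_idx a e c\<close>,
      so this value makes \<open>q\<close> times their number less than 1.\<close>
    define q where "q = 1 / (real a + 1)"
    have fin: "finite (gform_idx a e c)"
      by (rule finite_subset[of _ "{..<a}"]) (auto simp: gform_idx_def)
    have vg: "(\<Sum>k\<in>gform_idx a e c. of_real (q ^ k\<^sup>2) * v (a - 1 - k + u0) (e - 1 - k + u1) (2 * k + 2 - c + u2)) = 0"
      if "u0 + u1 + u2 = c" for u0 u1 u2
    proof -
      have "?X * 0 + ?Y * 0 + ?Z * 0 + gform a e c * Poly_Mapping.single (mon3 u0 u1 u2) 1 \<in> W"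
        by (intro WI is_form_0 is_form_single) (use that in auto)
      moreover have "gform a e c * Poly_Mapping.single (mon3 u0 u1 u2) 1 = (\<Sum>k\<in>gform_idx a e c.
        C (of_real (q ^ k\<^sup>2)) * Poly_Mapping.single (mon3 (a - 1 - k + u0) (e - 1 - k + u1) (2 * k + 2 - c + u2)) 1)"
        unfolding gform_def q_def sum_distrib_right by (simp add: mult_single mon3_add)
      ultimately have "0 = g (\<Sum>k\<in>gform_idx a e c.
        C (of_real (q ^ k\<^sup>2)) * Poly_Mapping.single (mon3 (a - 1 - k + u0) (e - 1 - k + u1) (2 * k + 2 - c + u2)) 1)"
        using g(3) by simp
      also have "\<dots> = (\<Sum>k\<in>gform_idx a e c. of_real (q ^ k\<^sup>2) * v (a - 1 - k + u0) (e - 1 - k + u1) (2 * k + 2 - c + u2))"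
        unfolding v_def by (simp only: g_sum[OF fin] g(2))
      finally show ?thesis by simp
    qed
    \<comment> \<open>Coordinates count down from the corner (a - 1, e - 1): the guard says exactly
      that the monomial is divisible by none of the pure powers. With c \<le> a and c \<le> e, no
      \<open>nat\<close> truncates there; elsewhere the default 0 agrees with
      \<open>v0\<close>.\<close>
    define z where "z x y = (if 0 \<le> x \<and> 0 \<le> y \<and> x + y + 3 \<le> int c
      then v (nat (int a - 1 - x)) (nat (int e - 1 - y)) (nat (2 + x + y)) else 0)" for x y
    have z0: "z x y = 0" for x y
    proof (rule hankel_kernel_trivial[where q = q and K = "int ` gform_idx a e c" and c = "int c"])
      show "0 < q" "q \<le> 1" by (simp_all add: q_def)
      have "card (int ` gform_idx a e c) \<le> a"
        using card_mono[of "{..<a}" "gform_idx a e c"] card_image_le[OF fin, of int]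
        by (force simp: gform_idx_def)
      then show "q * card (int ` gform_idx a e c) < 1" by (simp add: q_def field_simps)
      show "finite (int ` gform_idx a e c)" using fin by simp
    next
      fix x y assume "z x y \<noteq> 0"
      then show "0 \<le> x \<and> 0 \<le> y \<and> x + y + 3 \<le> int c" by (simp add: z_def split: if_splits)
    next
      fix k assume "int c \<le> 2 * k + 2" "k + 2 \<le> int c"
      then show "k \<in> int ` gform_idx a e c"
        using ce by (intro image_eqI[of _ _ "nat k"]) (auto simp: gform_idx_def)
    next
      fix u0 u1 :: int assume u: "0 \<le> u0" "0 \<le> u1" "u0 + u1 \<le> int c"
      have "z (int k - u0) (int k - u1) =
        v (a - 1 - k + nat u0) (e - 1 - k + nat u1) (2 * k + 2 - c + nat (int c - u0 - u1))"
        if k: "k \<in> gform_idx a e c" for k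
      proof (cases "u0 \<le> int k \<and> u1 \<le> int k \<and> 2 * int k - u0 - u1 + 3 \<le> int c")
        case True
        have "nat (int a - 1 - (int k - u0)) = a - 1 - k + nat u0" "nat (int e - 1 - (int k - u1)) = e - 1 - k + nat u1"
          "nat (2 + (int k - u0) + (int k - u1)) = 2 * k + 2 - c + nat (int c - u0 - u1)"
          using k u True by (auto simp: gform_idx_def nat_diff_distrib)
        then show ?thesis using True by (simp add: z_def)
      next
        case False
        \<comment> \<open>Outside the guard one exponent reaches \<open>a\<close>, \<open>e\<close>
          or \<open>c\<close>, so both sides are zero.\<close>
        have "v (a - 1 - k + nat u0) (e - 1 - k + nat u1) (2 * k + 2 - c + nat (int c - u0 - u1)) = 0"
          by (rule v0) (use k u False in \<open>auto simp: gform_idx_def\<close>)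
        then show ?thesis using False by (auto simp: z_def)
      qed
      then have "(\<Sum>k\<in>int ` gform_idx a e c. of_real (q powi k\<^sup>2) * z (k - u0) (k - u1)) =
        (\<Sum>k\<in>gform_idx a e c. of_real (q ^ k\<^sup>2) *
          v (a - 1 - k + nat u0) (e - 1 - k + nat u1) (2 * k + 2 - c + nat (int c - u0 - u1)))"
        by (subst sum.reindex) (auto intro!: sum.cong simp flip: of_nat_power simp: power_int_of_nat)
      also have "\<dots> = 0" by (rule vg) (use u in auto)
      finally show "(\<Sum>k\<in>int ` gform_idx a e c. of_real (q powi k\<^sup>2) * z (k - u0) (k - u1)) = 0" .
    qed
    have "v i j k = 0"
    proof (cases "a \<le> i \<or> e \<le> j \<or> c \<le> k")
      case True
      then show ?thesis using v0 ijk by blast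
    next
      case False
      have "nat (2 + (int a - 1 - int i) + (int e - 1 - int j)) = k"
        using ijk by simp
      then have "z (int a - 1 - int i) (int e - 1 - int j) = v i j k"
        using False ijk by (simp add: z_def)
      then show ?thesis using z0 by simp
    qed
    then show False using g(4) by (simp add: v_def)
  qed
  have "F = (\<Sum>\<mu>\<in>monoms (int a + int e). C (coef F \<mu>) * Poly_Mapping.single \<mu> 1)"
    by (subst sum_single_coef[OF F]) (simp add: mult_single)
  also have "\<dots> \<in> W"
    by (intro cp.subspace_sum[OF sub] cp.subspace_scale[OF sub]) (auto simp: monoms_iff intro!: mon_W)
  finally show ?thesis unfolding W_def by blast
qed

section \<open>The determinant map is generically onto or contained in a hypersurface\<close>

interpretation pol: fun_ring poly_fun
  by standard (auto intro: poly_fun.intros)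

text \<open>Taylor expansion around \<open>y\<close>, with \<open>Q m\<close> the homogeneous
  component of degree \<open>m\<close>. The components have to be in \<open>poly_fun\<close>
  themselves, because \<open>poly_fun_vanish\<close> restricts them to a further line.\<close>

lemma poly_fun_expand:
  assumes "P \<in> poly_fun"
  shows "\<exists>N Q. (\<forall>m. Q m \<in> poly_fun) \<and> (\<forall>m>N. \<forall>z. Q m z = 0) \<and>
    (\<forall>t z. P (y + C t * z) = (\<Sum>m\<le>N. Q m z * t ^ m))"
  using assms
proof (induction rule: poly_fun.induct)
  case (pf_const c)
  show ?case
    by (rule exI[of _ 0], rule exI[of _ "\<lambda>m z. if m = 0 then c else 0"]) (auto intro: poly_fun.pf_const)
next
  case (pf_coeff \<mu>)
  have "(\<lambda>z. if m = 0 then coef y \<mu> else if m = 1 then coef z \<mu> else 0) \<in> poly_fun" for m :: nat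
    by (cases "m = 0"; cases "m = 1") (auto intro: poly_fun.pf_const poly_fun.pf_coeff)
  then show ?case
    by (intro exI[of _ 1] exI[of _ "\<lambda>m z. if m = 0 then coef y \<mu> else if m = 1 then coef z \<mu> else 0"])
      (auto simp: lookup_add)
next
  case (pf_add p q)
  obtain N Q where p: "\<forall>m. Q m \<in> poly_fun" "\<forall>m>N. \<forall>z. Q m z = 0"
    "\<forall>t z. p (y + C t * z) = (\<Sum>m\<le>N. Q m z * t ^ m)" using pf_add by blast
  obtain N' Q' where q: "\<forall>m. Q' m \<in> poly_fun" "\<forall>m>N'. \<forall>z. Q' m z = 0"
    "\<forall>t z. q (y + C t * z) = (\<Sum>m\<le>N'. Q' m z * t ^ m)" using pf_add by blast
  have "(\<Sum>m\<le>N. Q m z * t ^ m) = (\<Sum>m\<le>max N N'. Q m z * t ^ m)" for t z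
    by (rule sum.mono_neutral_left) (use p(2) in auto)
  moreover have "(\<Sum>m\<le>N'. Q' m z * t ^ m) = (\<Sum>m\<le>max N N'. Q' m z * t ^ m)" for t z
    by (rule sum.mono_neutral_left) (use q(2) in auto)
  ultimately show ?case using p q
    by (intro exI[of _ "max N N'"] exI[of _ "\<lambda>m z. Q m z + Q' m z"])
      (auto simp: algebra_simps sum.distrib intro: poly_fun.pf_add)
next
  case (pf_mult p q)
  obtain N Q where p: "\<forall>m. Q m \<in> poly_fun" "\<forall>m>N. \<forall>z. Q m z = 0"
    "\<forall>t z. p (y + C t * z) = (\<Sum>m\<le>N. Q m z * t ^ m)" using pf_mult by blast
  obtain N' Q' where q: "\<forall>m. Q' m \<in> poly_fun" "\<forall>m>N'. \<forall>z. Q' m z = 0"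
    "\<forall>t z. q (y + C t * z) = (\<Sum>m\<le>N'. Q' m z * t ^ m)" using pf_mult by blast
  show ?case
  proof (intro exI[of _ "N + N'"] exI[of _ "\<lambda>m z. \<Sum>k\<le>m. Q k z * Q' (m - k) z"] conjI allI impI)
    fix m show "(\<lambda>z. \<Sum>k\<le>m. Q k z * Q' (m - k) z) \<in> poly_fun"
      using p(1) q(1) by (intro pol.sum pol.mult) auto
  next
    fix m z assume "N + N' < m"
    then have "Q k z = 0 \<or> Q' (m - k) z = 0" for k
      using p(2) q(2) by (cases "N < k") auto
    then show "(\<Sum>k\<le>m. Q k z * Q' (m - k) z) = 0" by (intro sum.neutral) auto
  next
    fix t z
    show "p (y + C t * z) * q (y + C t * z) = (\<Sum>m\<le>N + N'. (\<Sum>k\<le>m. Q k z * Q' (m - k) z) * t ^ m)"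
      using p q by (simp add: polynomial_product[of N "\<lambda>i. Q i z" N' "\<lambda>i. Q' i z" t])
  qed
qed

lemma poly_fun_line:
  assumes "P \<in> poly_fun" shows "\<exists>R. \<forall>t. P (y + C t * z) = poly R t"
proof -
  obtain N Q where "\<forall>t. P (y + C t * z) = (\<Sum>m\<le>N. Q m z * t ^ m)"
    using poly_fun_expand[OF assms, of y] by blast
  then show ?thesis
    by (intro exI[of _ "\<Sum>m\<le>N. monom (Q m z) m"]) (simp add: poly_sum poly_monom)
qed

text \<open>An algebraic substitute for letting t tend to 0: multiplied by the variable,
  \<open>R\<close> vanishes everywhere.\<close>

lemma poly_eq_0_punctured:
  fixes R :: "complex poly"
  assumes "\<And>t. t \<noteq> 0 \<Longrightarrow> poly R t = 0" shows "poly R 0 = 0"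
proof -
  have "\<forall>t. poly ([:0, 1:] * R) t = 0" using assms by auto
  then have "[:0, 1:] * R = 0" using poly_all_0_iff_0 by blast
  then show ?thesis by simp
qed

text \<open>The curve agrees with the line through \<open>y\<close> in direction \<open>z\<close> to first order, so every
  homogeneous component of \<open>P\<close> around \<open>y\<close> vanishes, the lowest one first.\<close>

lemma poly_fun_vanish:
  assumes P: "P \<in> poly_fun" and y: "is_form d y"
    and curve: "\<And>z. is_form d z \<Longrightarrow> \<exists>w. is_form d w \<and> (\<forall>t. P (y + C t * z + C (t\<^sup>2) * w) = 0)"
    and F: "is_form d F"
  shows "P F = 0"
proof -
  obtain N Q where Q: "\<And>m. Q m \<in> poly_fun" "\<And>m z. m > N \<Longrightarrow> Q m z = 0"
    "\<And>t z. P (y + C t * z) = (\<Sum>m\<le>N. Q m z * t ^ m)"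
    using poly_fun_expand[OF P, of y] by blast
  have Q0: "Q m z = 0" if "is_form d z" for m z
    using that
  proof (induction m arbitrary: z rule: less_induct)
    case (less m)
    obtain w where w: "is_form d w" "\<And>t. P (y + C t * z + C (t\<^sup>2) * w) = 0"
      using curve[OF less.prems] by blast
    have "\<forall>i. \<exists>R. \<forall>t. Q i (z + C t * w) = poly R t"
      using poly_fun_line[OF Q(1)] by blast
    then obtain S where S: "\<And>i t. Q i (z + C t * w) = poly (S i) t" by metis
    \<comment> \<open>The curve is y + t (z + t w). Components below \<open>m\<close> vanish at
      every form, in particular at z + t w, so dividing by t^m leaves \<open>?R\<close>, whose value
      at 0 is \<open>Q m z\<close>.\<close>
    let ?R = "\<Sum>i=m..N. monom 1 (i - m) * S i"
    have "poly ?R t = 0" if "t \<noteq> 0" for t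
    proof -
      have "C t * (z + C t * w) = C t * z + C (t\<^sup>2) * w"
        by (simp add: distrib_left mult.assoc[symmetric] mult_single power2_eq_square)
      then have "0 = P (y + C t * (z + C t * w))" using w(2)[of t] by (simp add: add.assoc)
      also have "\<dots> = (\<Sum>i\<le>N. Q i (z + C t * w) * t ^ i)" by (rule Q(3))
      also have "\<dots> = (\<Sum>i=m..N. Q i (z + C t * w) * t ^ i)"
      proof (rule sum.mono_neutral_right)
        show "\<forall>i\<in>{..N} - {m..N}. Q i (z + C t * w) * t ^ i = 0"
          using less.IH is_form_add[OF less.prems is_form_C_mult[OF w(1)]] by auto
      qed auto
      also have "\<dots> = t ^ m * poly ?R t"
        unfolding poly_sum sum_distrib_left
        by (rule sum.cong) (auto simp: S poly_monom power_add[symmetric])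
      finally show ?thesis using that by simp
    qed
    then have "poly ?R 0 = 0" by (rule poly_eq_0_punctured)
    moreover have "poly ?R 0 = (if m \<le> N then poly (S m) 0 else 0)"
    proof (cases "m \<le> N")
      case True
      have "poly ?R 0 = (\<Sum>i=m..N. if i = m then poly (S m) 0 else 0)"
        unfolding poly_sum by (rule sum.cong) (auto simp: poly_monom)
      then show ?thesis using True by simp
    qed auto
    ultimately show ?case using Q(2) S[of m 0] by (cases "m \<le> N") auto
  qed
  have "P F = P (y + C 1 * (F - y))" by simp
  also have "\<dots> = 0" unfolding Q(3) using Q0[OF is_form_diff[OF F y]] by simp
  finally show ?thesis .
qed

text \<open>Moving all four entries linearly in a parameter gives a determinant that is quadratic in
  it. Its linear part can be any form \<open>z\<close> by \<open>forms_spanned\<close>, so it is a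
  curve as required by \<open>poly_fun_vanish\<close>.\<close>

lemma det_image_dominant:
  fixes a e c :: nat
  assumes ce: "c \<le> a" "c \<le> e" and P: "P \<in> poly_fun"
    and van: "\<And>f11 f12 f21 f22. is_form (int a) f11 \<Longrightarrow> is_form (int a + int e - int c) f12 \<Longrightarrow>
      is_form (int c) f21 \<Longrightarrow> is_form (int e) f22 \<Longrightarrow> P (f11 * f22 - f12 * f21) = 0"
    and F: "is_form (int a + int e) F"
  shows "P F = 0"
proof -
  let ?X = "Poly_Mapping.single (mon3 a 0 0) 1 :: cpoly" and ?Y = "Poly_Mapping.single (mon3 0 e 0) 1 :: cpoly"
    and ?Z = "Poly_Mapping.single (mon3 0 0 c) 1 :: cpoly" and ?G = "gform a e c"
  have X: "is_form (int a) ?X" and Y: "is_form (int e) ?Y" and Z: "is_form (int c) ?Z"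
    by (intro is_form_single; simp)+
  have deg: "is_form (int a + int e) (f * g)" if "is_form (int a + int e - int c) f" "is_form (int c) g" for f g
    using is_form_mult[OF that] by simp
  show ?thesis
  proof (rule poly_fun_vanish[OF P _ _ F])
    show "is_form (int a + int e) (?X * ?Y - ?G * ?Z)"
      by (intro is_form_diff is_form_mult X Y deg Z is_form_gform)
  next
    fix z assume "is_form (int a + int e) z"
    then obtain u w y t where f: "is_form (int e) u" "is_form (int a) w" "is_form (int a + int e - int c) y"
      "is_form (int c) t" and z: "z = ?X * u + ?Y * w + ?Z * y + ?G * t"
      using forms_spanned[OF ce] by blast
    show "\<exists>w. is_form (int a + int e) w \<and> (\<forall>t. P (?X * ?Y - ?G * ?Z + C t * z + C (t\<^sup>2) * w) = 0)"
    proof (intro exI conjI allI)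
      show "is_form (int a + int e) (w * u - y * t)"
        by (intro is_form_diff is_form_mult deg f)
      fix s
      have "P ((?X + C s * w) * (?Y + C s * u) - (?G - C s * y) * (?Z - C s * t)) = 0"
        by (intro van is_form_add is_form_diff is_form_C_mult X Y Z is_form_gform f)
      moreover have "C (s\<^sup>2) = C s * C s" by (simp add: mult_single power2_eq_square)
      then have "(?X + C s * w) * (?Y + C s * u) - (?G - C s * y) * (?Z - C s * t)
        = ?X * ?Y - ?G * ?Z + C s * z + C (s\<^sup>2) * (w * u - y * t)"
        unfolding z by (simp only:) (simp add: algebra_simps)
      ultimately show "P (?X * ?Y - ?G * ?Z + C s * z + C (s\<^sup>2) * (w * u - y * t)) = 0" by simp
    qed
  qed
qed

section \<open>Forms in coordinates, and the passage from a dense to an open set\<close>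

definition form_of :: "nat \<Rightarrow> int \<Rightarrow> (nat \<times> monom \<Rightarrow> complex) \<Rightarrow> cpoly" where
  "form_of k m v = (\<Sum>\<mu>\<in>monoms m. Poly_Mapping.single \<mu> (v (k, \<mu>)))"

lemma is_form_form_of: "is_form m (form_of k m v)"
  unfolding form_of_def by (intro is_form_sum is_form_single)

lemma coef_form_of: "coef (form_of k m v) \<mu> = (if \<mu> \<in> monoms m then v (k, \<mu>) else 0)"
  by (auto simp: form_of_def lookup_sum lookup_single when_def sum.delta finite_monoms)

lemma form_of_eqI:
  "is_form m F \<Longrightarrow> (\<And>\<mu>. \<mu> \<in> monoms m \<Longrightarrow> v (k, \<mu>) = coef F \<mu>) \<Longrightarrow> form_of k m v = F"
  by (rule poly_mapping_eqI) (simp add: coef_form_of is_form_coef)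

lemma pfun_coef_form_of: "(\<lambda>v. coef (form_of k m v) \<mu>) \<in> pfun"
  by (cases "\<mu> \<in> monoms m") (auto simp: coef_form_of intro: pfun.const pfun.var)

lemma pfun_coef_mult_form_of:
  "(\<lambda>v. coef (form_of k m v * form_of l n v) \<mu>) \<in> pfun"
proof -
  have "(\<lambda>v. if \<alpha> + \<beta> = \<mu> then coef (form_of k m v) \<alpha> * coef (form_of l n v) \<beta> else 0) \<in> pfun" for \<alpha> \<beta>
    by (cases "\<alpha> + \<beta> = \<mu>") (auto intro: pfun.const pfun.mult pfun_coef_form_of)
  then show ?thesis
    unfolding coef_mult_forms[OF is_form_form_of is_form_form_of] by (intro pf.sum)
qed

lemma pfun_comp_poly_fun:
  assumes "f \<in> pfun" "\<And>x. (\<lambda>F. h F x) \<in> poly_fun" shows "(\<lambda>F. f (h F)) \<in> poly_fun"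
  using assms(1) by induction (auto intro: assms(2) poly_fun.intros)

text \<open>The determinants form a projection of the graph of a polynomial map, hence a
  constructible set \<open>E\<close>. Either \<open>E\<close> contains a basic open set, or the
  polynomial defining one vanishes on all determinants, which \<open>dom\<close> forbids.\<close>

lemma general_form_det:
  assumes ad: "a + e = b + c"
    and dom: "\<And>P F. P \<in> poly_fun \<Longrightarrow> (\<And>G. is_det_degmat a b c e G \<Longrightarrow> P G = 0) \<Longrightarrow>
      is_form (a + e) F \<Longrightarrow> P F = 0"
  shows "general_form (a + e) (is_det_degmat a b c e)"
proof -
  \<comment> \<open>The tag in the first component lets a single assignment carry five forms: 1 to 4
    are the matrix entries, 0 is the target. Projection eliminates \<open>V\<close>, which contains
    no tag 0.\<close>
  define D where "D v = form_of 1 a v * form_of 4 e v - form_of 2 b v * form_of 3 c v" for v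
  define X where "X = {v. \<forall>\<mu>\<in>monoms (a + e). v (0, \<mu>) - coef (D v) \<mu> = 0}"
  define V :: "(nat \<times> monom) set" where
    "V = {1, 2, 3, 4} \<times> (monoms a \<union> monoms b \<union> monoms c \<union> monoms e)"
  define E where "E = {v. \<exists>w\<in>X. \<forall>y. y \<notin> V \<longrightarrow> w y = v y}"
  have D: "is_form (a + e) (D v)" for v
    unfolding D_def using ad by (metis is_form_diff is_form_mult is_form_form_of)
  have "X \<in> pf.constr"
    unfolding X_def D_def lookup_minus
    by (intro pf.constr_INT finite_monoms pf.diff pfun.var pfun_coef_mult_form_of)
  then have "E \<in> pf.constr"
    unfolding E_def by (intro constr_ex_vars) (auto simp: V_def finite_monoms)
  then obtain f where f: "f \<in> pfun" "\<exists>v. f v \<noteq> 0" "{v. f v \<noteq> 0} \<subseteq> E \<or> {v. f v \<noteq> 0} \<inter> E = {}"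
    using constr_dichotomy by blast
  then obtain w0 where w0: "f w0 \<noteq> 0" by blast
  have E_iff: "v \<in> E \<longleftrightarrow> is_det_degmat a b c e (form_of 0 (a + e) v)" for v
  proof
    assume "v \<in> E"
    then obtain w where w: "w \<in> X" "\<forall>y. y \<notin> V \<longrightarrow> w y = v y" by (auto simp: E_def)
    have "form_of 0 (a + e) v = D w"
      by (rule form_of_eqI[OF D]) (use w in \<open>auto simp: X_def V_def\<close>)
    then show "is_det_degmat a b c e (form_of 0 (a + e) v)"
      unfolding is_det_degmat_def D_def using is_form_form_of by blast
  next
    assume "is_det_degmat a b c e (form_of 0 (a + e) v)"
    then obtain f11 f12 f21 f22 where fs: "is_form a f11" "is_form b f12" "is_form c f21" "is_form e f22"
      and det: "form_of 0 (a + e) v = f11 * f22 - f12 * f21" unfolding is_det_degmat_def by blast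
    define w where "w y = (if y \<in> V then coef (if fst y = 1 then f11 else if fst y = 2 then f12
      else if fst y = 3 then f21 else f22) (snd y) else v y)" for y
    have "form_of 1 a w = f11" "form_of 2 b w = f12" "form_of 3 c w = f21" "form_of 4 e w = f22"
      by (rule form_of_eqI; use fs in \<open>simp add: w_def V_def\<close>)+
    then have "D w = form_of 0 (a + e) v" by (simp add: D_def det)
    then have "w \<in> X" by (auto simp: X_def coef_form_of w_def V_def)
    then show "v \<in> E" unfolding E_def by (auto simp: w_def intro!: bexI[of _ w])
  qed
  \<comment> \<open>\<open>f\<close> may also depend on coordinates that do not describe the target
    form. They are frozen at \<open>w0\<close>, where \<open>f\<close> is nonzero, so that
    \<open>f\<close> becomes a polynomial function of \<open>F\<close> that is not identically
    zero.\<close>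
  define h where "h F y = (if fst y = 0 \<and> snd y \<in> monoms (a + e) then coef F (snd y) else w0 y)" for F y
  have h_form: "form_of 0 (a + e) (h F) = F" if "is_form (a + e) F" for F
    by (rule form_of_eqI[OF that]) (simp add: h_def)
  have "(\<lambda>F. h F y) \<in> poly_fun" for y
    by (cases "fst y = 0 \<and> snd y \<in> monoms (a + e)") (auto simp: h_def intro: poly_fun.intros)
  then have p: "(\<lambda>F. f (h F)) \<in> poly_fun" by (rule pfun_comp_poly_fun[OF f(1)])
  define F0 where "F0 = form_of 0 (a + e) w0"
  have "h F0 = w0" by (rule ext) (auto simp: h_def F0_def coef_form_of prod_eq_iff split: prod.splits)
  then have F0: "is_form (a + e) F0" "f (h F0) \<noteq> 0" using w0 by (auto simp: F0_def is_form_form_of)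
  have "{v. f v \<noteq> 0} \<subseteq> E"
  proof (rule ccontr)
    assume "\<not> {v. f v \<noteq> 0} \<subseteq> E"
    then have disj: "{v. f v \<noteq> 0} \<inter> E = {}" using f(3) by blast
    have "f (h G) = 0" if "is_det_degmat a b c e G" for G
    proof -
      have "is_form (a + e) G"
        using that ad unfolding is_det_degmat_def by (metis is_form_diff is_form_mult)
      then have "h G \<in> E" using that by (simp add: E_iff h_form)
      then show ?thesis using disj by blast
    qed
    then show False using dom[OF p _ F0(1)] F0(2) by blast
  qed
  then have "is_det_degmat a b c e F" if "is_form (a + e) F" "f (h F) \<noteq> 0" for F
    using that E_iff[of "h F"] h_form[OF that(1)] by auto
  then show ?thesis
    unfolding general_form_def zariski_open_forms_def forms_def
    using p F0 by (intro exI[of _ "{F \<in> {F. is_form (a + e) F}. \<exists>p\<in>{\<lambda>F. f (h F)}. p F \<noteq> 0}"] conjI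
      exI[of _ "{\<lambda>F. f (h F)}"]) auto
qed

section \<open>Products of forms\<close>

lemma subseq_finite_index:
  fixes x :: "nat \<Rightarrow> 'i \<Rightarrow> complex"
  assumes "finite I" "\<And>n i. i \<in> I \<Longrightarrow> norm (x n i) \<le> 1"
  shows "\<exists>r :: nat \<Rightarrow> nat. strict_mono r \<and> (\<forall>i\<in>I. \<exists>l. (\<lambda>n. x (r n) i) \<longlonglongrightarrow> l)"
  using assms
proof (induction I rule: finite_induct)
  case empty
  show ?case by (auto intro: exI[of _ id] strict_mono_id)
next
  case (insert j I)
  then obtain r :: "nat \<Rightarrow> nat" where r: "strict_mono r" "\<forall>i\<in>I. \<exists>l. (\<lambda>n. x (r n) i) \<longlonglongrightarrow> l" by auto
  obtain s :: "nat \<Rightarrow> nat" and l where s: "strict_mono s"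
    and l: "\<forall>\<epsilon>>0. \<exists>N. \<forall>n\<ge>N. norm (x (r (s n)) j - l) < \<epsilon>"
    using Bolzano_Weierstrass_complex_disc[of "\<lambda>n. x (r n) j" 1] insert.prems by auto
  have "(\<lambda>n. x (r (s n)) j) \<longlonglongrightarrow> l" using l by (simp add: LIMSEQ_def dist_norm)
  moreover have "\<exists>l. (\<lambda>n. x (r (s n)) i) \<longlonglongrightarrow> l" if "i \<in> I" for i
    using r(2) that LIMSEQ_subseq_LIMSEQ[OF _ s] by (fastforce simp: o_def)
  ultimately show ?case
    using strict_mono_o[OF r(1) s] by (intro exI[of _ "\<lambda>n. r (s n)"]) (auto simp: o_def)
qed

definition coef_norm :: "int \<Rightarrow> cpoly \<Rightarrow> real" where
  "coef_norm m F = (\<Sum>\<mu>\<in>monoms m. norm (coef F \<mu>))"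

lemma coef_norm_C_mult: "coef_norm m (C r * F) = norm r * coef_norm m F"
  by (simp add: coef_norm_def norm_mult sum_distrib_left)

lemma coef_norm_pos:
  assumes "is_form m F" "F \<noteq> 0" shows "0 < coef_norm m F"
proof -
  obtain \<mu> where "coef F \<mu> \<noteq> 0" using assms(2) by (metis lookup_zero poly_mapping_eqI)
  moreover from this have "\<mu> \<in> monoms m" using assms(1) is_form_coef by blast
  ultimately show ?thesis
    unfolding coef_norm_def by (intro sum_pos2[OF finite_monoms]) auto
qed

text \<open>Compactness of the unit sphere in a finite-dimensional space; the norm passes to the
  limit, which is therefore nonzero.\<close>

lemma form_subseq:
  assumes f: "\<And>n. is_form m (f n)" "\<And>n. coef_norm m (f n) = 1"
  shows "\<exists>(r :: nat \<Rightarrow> nat) F. strict_mono r \<and> is_form m F \<and> F \<noteq> 0 \<and>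
    (\<forall>\<mu>. (\<lambda>n. coef (f (r n)) \<mu>) \<longlonglongrightarrow> coef F \<mu>)"
proof -
  have "norm (coef (f n) \<mu>) \<le> 1" if "\<mu> \<in> monoms m" for n \<mu>
    using member_le_sum[OF that, of "\<lambda>\<mu>. norm (coef (f n) \<mu>)"] f(2)[of n] finite_monoms
    by (simp add: coef_norm_def)
  then obtain r :: "nat \<Rightarrow> nat" where r: "strict_mono r"
    "\<forall>\<mu>\<in>monoms m. \<exists>l. (\<lambda>n. coef (f (r n)) \<mu>) \<longlonglongrightarrow> l"
    using subseq_finite_index[OF finite_monoms, of m "\<lambda>n. coef (f n)"] by blast
  then obtain L where L: "\<And>\<mu>. \<mu> \<in> monoms m \<Longrightarrow> (\<lambda>n. coef (f (r n)) \<mu>) \<longlonglongrightarrow> L \<mu>" by metis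
  define F where "F = form_of 0 m (\<lambda>(k, \<mu>). L \<mu>)"
  have lim: "(\<lambda>n. coef (f (r n)) \<mu>) \<longlonglongrightarrow> coef F \<mu>" for \<mu>
    using L[of \<mu>] by (cases "\<mu> \<in> monoms m") (simp_all add: F_def coef_form_of is_form_coef[OF f(1)])
  have "(\<lambda>n. coef_norm m (f (r n))) \<longlonglongrightarrow> coef_norm m F"
    unfolding coef_norm_def by (intro tendsto_intros lim)
  then have "coef_norm m F = 1" using f(2) by (simp add: LIMSEQ_const_iff)
  then have "F \<noteq> 0" by (auto simp: coef_norm_def)
  moreover have "is_form m F" by (simp add: F_def is_form_form_of)
  ultimately show ?thesis using r(1) lim by blast
qed

text \<open>The factors need not stay bounded, as one may shrink while the other grows. Both are
  therefore normalized, and the scalar \<open>\<kappa>\<close> collects the norms; its convergence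
  has to be derived from that of the products.\<close>

lemma form_products_closed:
  assumes fg: "\<And>n. is_form m (f n)" "\<And>n. is_form k (g n)"
    and lim: "\<And>\<mu>. (\<lambda>n. coef (f n * g n) \<mu>) \<longlonglongrightarrow> coef G \<mu>" and "G \<noteq> 0"
  shows "\<exists>F K. is_form m F \<and> is_form k K \<and> G = F * K"
proof -
  obtain \<mu>0 where "coef G \<mu>0 \<noteq> 0" using \<open>G \<noteq> 0\<close> by (metis lookup_zero poly_mapping_eqI)
  \<comment> \<open>Discarding an initial segment makes all products nonzero, so that no
    normalization divides by zero.\<close>
  then have "\<forall>\<^sub>F n in sequentially. coef (f n * g n) \<mu>0 \<noteq> 0"
    using tendsto_imp_eventually_ne[OF lim] by blast
  then obtain N where N: "\<And>n. n \<ge> N \<Longrightarrow> f n * g n \<noteq> 0"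
    unfolding eventually_sequentially by (metis lookup_zero)
  define u where "u n = C (of_real (1 / coef_norm m (f (n + N)))) * f (n + N)" for n
  define w where "w n = C (of_real (1 / coef_norm k (g (n + N)))) * g (n + N)" for n
  define \<kappa> :: "nat \<Rightarrow> complex" where
    "\<kappa> n = of_real (coef_norm m (f (n + N)) * coef_norm k (g (n + N)))" for n
  have pos: "0 < coef_norm m (f (n + N))" "0 < coef_norm k (g (n + N))" for n
    using N[of "n + N"] by (auto intro!: coef_norm_pos fg)
  have u: "is_form m (u n)" "coef_norm m (u n) = 1" and w: "is_form k (w n)" "coef_norm k (w n) = 1" for n
    unfolding u_def w_def coef_norm_C_mult norm_of_real using pos[of n] by (auto intro!: is_form_C_mult fg)
  have CC: "C x * y * (C x' * y') = C (x * x') * (y * y')" for x y x' y'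
    using mult_single[of "0 :: monom" x 0 x'] by (simp add: mult_ac del: mult_eq_0_iff)
  have uw: "C (\<kappa> n) * (u n * w n) = f (n + N) * g (n + N)" for n
  proof -
    have "\<kappa> n * (of_real (1 / coef_norm m (f (n + N))) * of_real (1 / coef_norm k (g (n + N)))) = 1"
      using pos[of n] by (simp add: \<kappa>_def)
    then show ?thesis
      unfolding u_def w_def CC by (simp only: mult.assoc[symmetric] mult_single add_0 single_one mult_1_left)
  qed
  obtain r F where r: "strict_mono r" and F: "is_form m F" "F \<noteq> 0"
    "\<And>\<mu>. (\<lambda>n. coef (u (r n)) \<mu>) \<longlonglongrightarrow> coef F \<mu>"
    using form_subseq[of m u] u by blast
  obtain s K where s: "strict_mono s" and K: "is_form k K" "K \<noteq> 0"
    "\<And>\<mu>. (\<lambda>n. coef (w (r (s n))) \<mu>) \<longlonglongrightarrow> coef K \<mu>"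
    using form_subseq[of k "\<lambda>n. w (r n)"] w by blast
  define i where "i n = r (s n)" for n
  have "(\<lambda>n. coef (u (i n)) \<mu>) \<longlonglongrightarrow> coef F \<mu>" for \<mu>
    using LIMSEQ_subseq_LIMSEQ[OF F(3) s] by (simp add: i_def o_def)
  then have uw_lim: "(\<lambda>n. coef (u (i n) * w (i n)) \<mu>) \<longlonglongrightarrow> coef (F * K) \<mu>" for \<mu>
    unfolding coef_mult_forms[OF u(1) w(1)] coef_mult_forms[OF F(1) K(1)]
    using K(3) by (intro tendsto_sum) (auto intro!: tendsto_mult simp: i_def)
  have fg_lim: "(\<lambda>n. \<kappa> (i n) * coef (u (i n) * w (i n)) \<mu>) \<longlonglongrightarrow> coef G \<mu>" for \<mu>
  proof -
    have "strict_mono (\<lambda>n. i n + N)" using r s by (simp add: strict_mono_def i_def)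
    then have "(\<lambda>n. coef (f (i n + N) * g (i n + N)) \<mu>) \<longlonglongrightarrow> coef G \<mu>"
      using LIMSEQ_subseq_LIMSEQ[OF lim] by (fastforce simp: o_def)
    then show ?thesis unfolding uw[symmetric] by simp
  qed
  \<comment> \<open>The limits are nonzero and there are no zero divisors, so \<open>F * K\<close>
    has a nonzero coefficient; the ratio of coefficients there determines the limit of
    \<open>\<kappa>\<close>.\<close>
  obtain \<mu>1 where \<mu>1: "coef (F * K) \<mu>1 \<noteq> 0"
    using F(2) K(2) by (metis lookup_zero no_zero_divisors poly_mapping_eqI)
  have "(\<lambda>n. \<kappa> (i n) * coef (u (i n) * w (i n)) \<mu>1 / coef (u (i n) * w (i n)) \<mu>1)
    \<longlonglongrightarrow> coef G \<mu>1 / coef (F * K) \<mu>1"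
    by (intro tendsto_divide fg_lim uw_lim \<mu>1)
  moreover have "\<forall>\<^sub>F n in sequentially.
    \<kappa> (i n) * coef (u (i n) * w (i n)) \<mu>1 / coef (u (i n) * w (i n)) \<mu>1 = \<kappa> (i n)"
    using tendsto_imp_eventually_ne[OF uw_lim \<mu>1] by eventually_elim simp
  ultimately have \<kappa>_lim: "(\<lambda>n. \<kappa> (i n)) \<longlonglongrightarrow> coef G \<mu>1 / coef (F * K) \<mu>1"
    by (rule Lim_transform_eventually)
  have coef_G: "coef G \<mu> = coef G \<mu>1 / coef (F * K) \<mu>1 * coef (F * K) \<mu>" for \<mu>
    by (rule LIMSEQ_unique[OF fg_lim tendsto_mult[OF \<kappa>_lim uw_lim]])
  have "G = C (coef G \<mu>1 / coef (F * K) \<mu>1) * (F * K)"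
    by (intro poly_mapping_eqI) (unfold coef_C_mult, rule coef_G)
  then have "G = (C (coef G \<mu>1 / coef (F * K) \<mu>1) * F) * K" by (simp add: mult.assoc)
  then show ?thesis using F(1) K(1) is_form_C_mult by blast
qed

text \<open>Dehomogenization at \<open>x\<^sub>1 = 1\<close>, as a polynomial in \<open>x\<^sub>2\<close> over the polynomials in \<open>x\<^sub>0\<close>.\<close>

definition dehom :: "int \<Rightarrow> cpoly \<Rightarrow> complex poly poly" where
  "dehom m F = (\<Sum>\<mu>\<in>monoms m.
     monom (monom (coef F \<mu>) (Poly_Mapping.lookup \<mu> 0)) (Poly_Mapping.lookup \<mu> 2))"

lemma dehom_mult:
  assumes "is_form m F" "is_form n G"
  shows "dehom (m + n) (F * G) = dehom m F * dehom n G"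
proof -
  let ?M = "\<lambda>\<mu> x :: complex. monom (monom x (Poly_Mapping.lookup \<mu> 0)) (Poly_Mapping.lookup \<mu> (2 :: nat))"
  have M_sum: "?M \<mu> (\<Sum>i\<in>I. h i) = (\<Sum>i\<in>I. ?M \<mu> (h i))" for \<mu> and I :: "monom set" and h
    by (induction I rule: infinite_finite_induct) (auto simp: add_monom[symmetric])
  have "dehom (m + n) (F * G) = (\<Sum>\<mu>\<in>monoms (m + n). \<Sum>\<alpha>\<in>monoms m. \<Sum>\<beta>\<in>monoms n.
    if \<alpha> + \<beta> = \<mu> then ?M \<mu> (coef F \<alpha> * coef G \<beta>) else 0)"
    unfolding dehom_def coef_mult_forms[OF assms] M_sum by (intro sum.cong refl) simp
  also have "\<dots> = (\<Sum>\<alpha>\<in>monoms m. \<Sum>\<beta>\<in>monoms n. \<Sum>\<mu>\<in>monoms (m + n).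
    if \<alpha> + \<beta> = \<mu> then ?M \<mu> (coef F \<alpha> * coef G \<beta>) else 0)"
    by (rule trans[OF sum.swap], rule sum.cong[OF refl], rule sum.swap)
  also have "\<dots> = (\<Sum>\<alpha>\<in>monoms m. \<Sum>\<beta>\<in>monoms n. ?M \<alpha> (coef F \<alpha>) * ?M \<beta> (coef G \<beta>))"
    by (intro sum.cong refl) (simp add: sum.delta finite_monoms monoms_add mult_monom lookup_add)
  also have "\<dots> = dehom m F * dehom n G"
    by (simp add: dehom_def sum_product)
  finally show ?thesis .
qed

lemma mon3_in_monoms_edge:
  "\<mu> \<in> monoms (int m) \<Longrightarrow> Poly_Mapping.lookup \<mu> 0 = m \<Longrightarrow> \<mu> = mon3 m 0 0"
  by (auto simp: monoms_iff lookup_mon3)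

lemma coeff_dehom: "coeff (coeff (dehom (int m) F) 0) m = coef F (mon3 m 0 0)"
proof -
  have "coeff (coeff (dehom (int m) F) 0) m = (\<Sum>\<mu>\<in>monoms (int m). if \<mu> = mon3 m 0 0 then coef F \<mu> else 0)"
    unfolding dehom_def coeff_sum
    by (intro sum.cong refl) (auto simp: lookup_mon3 dest: mon3_in_monoms_edge)
  then show ?thesis by (simp add: sum.delta finite_monoms)
qed

text \<open>The top power of x_0 arises only from the top powers in both factors. Hence every factor
  of \<open>irr_form\<close> contains a pure power of x_0, which survives dehomogenization.\<close>

lemma coef_mult_edge:
  assumes "is_form (int m) F" "is_form (int n) G"
  shows "coef (F * G) (mon3 (m + n) 0 0) = coef F (mon3 m 0 0) * coef G (mon3 n 0 0)"
proof -
  have "\<alpha> + \<beta> = mon3 (m + n) 0 0 \<longleftrightarrow> \<alpha> = mon3 m 0 0 \<and> \<beta> = mon3 n 0 0"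
    if "\<alpha> \<in> monoms (int m)" "\<beta> \<in> monoms (int n)" for \<alpha> \<beta>
    using that by (auto simp: monoms_iff mon3_add)
  then have "coef (F * G) (mon3 (m + n) 0 0) = (\<Sum>\<alpha>\<in>monoms (int m). \<Sum>\<beta>\<in>monoms (int n).
      if \<alpha> = mon3 m 0 0 then if \<beta> = mon3 n 0 0 then coef F \<alpha> * coef G \<beta> else 0 else 0)"
    unfolding coef_mult_forms[OF assms] by (intro sum.cong refl) auto
  also have "\<dots> = (\<Sum>\<alpha>\<in>monoms (int m). if \<alpha> = mon3 m 0 0 then coef F \<alpha> * coef G (mon3 n 0 0) else 0)"
    by (intro sum.cong refl) (simp add: sum.delta finite_monoms)
  finally show ?thesis by (simp add: sum.delta finite_monoms)
qed

definition irr_form :: "nat \<Rightarrow> cpoly" where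
  "irr_form d = Poly_Mapping.single (mon3 d 0 0) 1 + Poly_Mapping.single (mon3 0 (d - 1) 1) 1"

lemma is_form_irr_form: "0 < d \<Longrightarrow> is_form (int d) (irr_form d)"
  unfolding irr_form_def by (intro is_form_add is_form_single) auto

lemma coef_irr_form: "coef (irr_form d) \<mu> = (if \<mu> = mon3 d 0 0 \<or> \<mu> = mon3 0 (d - 1) 1 then 1 else 0)"
  by (auto simp: irr_form_def lookup_add lookup_single when_def)

lemma dehom_irr_form:
  assumes "0 < d" shows "dehom (int d) (irr_form d) = [:monom 1 d, 1:]"
proof -
  have "dehom (int d) (irr_form d) = (\<Sum>\<mu>\<in>{mon3 d 0 0, mon3 0 (d - 1) 1}.
    monom (monom (coef (irr_form d) \<mu>) (Poly_Mapping.lookup \<mu> 0)) (Poly_Mapping.lookup \<mu> 2))"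
    unfolding dehom_def
    by (rule sum.mono_neutral_right) (use assms in \<open>auto simp: finite_monoms coef_irr_form\<close>)
  then show ?thesis by (simp add: coef_irr_form lookup_mon3 monom_0 monom_Suc)
qed

text \<open>Setting \<open>x\<^sub>1 = 1\<close> makes the form monic of degree one in \<open>x\<^sub>2\<close>, so one factor becomes constant.\<close>

lemma irr_form_not_product:
  assumes "0 < m" "0 < n" "is_form (int m) F" "is_form (int n) G"
  shows "irr_form (m + n) \<noteq> F * G"
proof
  assume eq: "irr_form (m + n) = F * G"
  have "coef F (mon3 m 0 0) * coef G (mon3 n 0 0) = 1"
    using coef_mult_edge[OF assms(3,4)] by (simp add: eq[symmetric] coef_irr_form)
  then have nz: "coef F (mon3 m 0 0) \<noteq> 0" "coef G (mon3 n 0 0) \<noteq> 0" by auto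
  have prod: "dehom (int m) F * dehom (int n) G = [:monom 1 (m + n), 1:]"
    using dehom_mult[OF assms(3,4)] dehom_irr_form[of "m + n"] assms(1) eq by simp
  then have "dehom (int m) F \<noteq> 0" "dehom (int n) G \<noteq> 0" by auto
  then have deg: "degree (dehom (int m) F) + degree (dehom (int n) G) = 1"
    using degree_mult_eq[of "dehom (int m) F" "dehom (int n) G"] prod by simp
  \<comment> \<open>A factor of degree zero in x_2 is a polynomial \<open>u\<close> in x_0 alone.
    Comparing coefficients of x_2 gives \<open>u dvd 1\<close>, so \<open>u\<close> is a scalar,
    although its coefficient at x_0^k with k > 0 is nonzero.\<close>
  have const: False if "0 < k" "P * Q = [:monom 1 l, 1:]" "degree P = 0" "coeff (coeff P 0) k \<noteq> 0"
    for P Q :: "complex poly poly" and k l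
  proof -
    obtain u where u: "P = [:u:]" using \<open>degree P = 0\<close> by (metis degree_eq_zeroE)
    have "coeff (P * Q) 1 = 1" using that(2) by simp
    then have "u * coeff Q 1 = 1" using u by simp
    then have "u dvd 1" by (metis dvdI)
    then have "degree u = 0" using is_unit_iff_degree[of u] by (cases "u = 0") auto
    then show False using that(1,4) u by (simp add: coeff_eq_0)
  qed
  show False
  proof (cases "degree (dehom (int m) F) = 0")
    case True
    then show False using const[OF assms(1) prod] nz coeff_dehom by simp
  next
    case False
    then have "degree (dehom (int n) G) = 0" using deg by simp
    then show False using const[OF assms(2), of "dehom (int n) G" "dehom (int m) F" "m + n"] prod nz coeff_dehom
      by (simp add: mult.commute)
  qed
qed

text \<open>The form \<open>irr_form d\<close> is approached by members of \<open>U\<close> on the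
  line joining it to some \<open>F0\<close> in \<open>U\<close>; closedness of products then makes
  it a product, against \<open>irr_form_not_product\<close>.\<close>

lemma not_general_product:
  assumes gen: "general_form (m + n) (\<lambda>F. \<exists>f g. is_form m f \<and> is_form n g \<and> F = f * g)"
    and d: "m + n > 0" and mn: "m \<noteq> 0" "n \<noteq> 0"
  shows False
proof -
  define d where "d = nat (m + n)"
  have d_int: "m + n = int d" "0 < d" using d by (simp_all add: d_def)
  let ?G = "irr_form d"
  obtain U where U: "zariski_open_forms (m + n) U" "U \<noteq> {}"
    "\<And>F. F \<in> U \<Longrightarrow> \<exists>f g. is_form m f \<and> is_form n g \<and> F = f * g"
    using gen unfolding general_form_def by blast
  obtain S where S: "S \<subseteq> poly_fun" "U = {F. is_form (m + n) F \<and> (\<exists>p\<in>S. p F \<noteq> 0)}"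
    using U(1) by (auto simp: zariski_open_forms_def forms_def)
  then obtain F0 p where p: "p \<in> poly_fun" "p \<in> S" "is_form (m + n) F0" "p F0 \<noteq> 0"
    using U(2) by blast
  obtain R where R: "\<And>t. p (?G + C t * (F0 - ?G)) = poly R t"
    using poly_fun_line[OF p(1)] by blast
  have "poly R 1 \<noteq> 0" using R[of 1] p(4) by simp
  then have "finite {t. poly R t = 0}" by (intro poly_roots_finite) auto
  \<comment> \<open>Only finitely many parameters 1 / (k + 1) can be roots of \<open>R\<close>;
    \<open>N\<close> skips them, and the rest tend to 0, the parameter of \<open>?G\<close>.\<close>
  moreover have "inj (\<lambda>k. 1 / of_nat (Suc k) :: complex)"
    by (rule injI) (simp add: field_simps del: of_nat_Suc)
  ultimately have "finite {k. poly R (1 / of_nat (Suc k)) = 0}"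
    using finite_vimageI[of "{t. poly R t = 0}" "\<lambda>k. 1 / of_nat (Suc k)"] by (simp add: vimage_def)
  then obtain N where roots: "{k. poly R (1 / of_nat (Suc k)) = 0} \<subseteq> {..<N}"
    using finite_nat_bounded by blast
  have N: "poly R (1 / of_nat (Suc (k + N))) \<noteq> 0" for k
    using subsetD[OF roots, of "k + N"] by auto
  define H where "H k = ?G + C (1 / of_nat (Suc (k + N))) * (F0 - ?G)" for k
  have G: "is_form (m + n) ?G" using is_form_irr_form d_int by simp
  have "\<exists>f g. is_form m f \<and> is_form n g \<and> H k = f * g" for k
  proof (rule U(3))
    have "is_form (m + n) (H k)"
      unfolding H_def by (intro is_form_add is_form_C_mult is_form_diff G p(3))
    moreover have "p (H k) \<noteq> 0" using N R by (simp add: H_def)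
    ultimately show "H k \<in> U" using p(2) by (auto simp: S(2))
  qed
  then obtain f g where fg: "\<And>k. is_form m (f k)" "\<And>k. is_form n (g k)" "\<And>k. H k = f k * g k" by metis
  have "(\<lambda>k. coef ?G \<mu> + 1 / of_nat (Suc (k + N)) * coef (F0 - ?G) \<mu>) \<longlonglongrightarrow> coef ?G \<mu> + 0 * coef (F0 - ?G) \<mu>" for \<mu>
    by (intro tendsto_intros LIMSEQ_ignore_initial_segment[where f = "\<lambda>k. 1 / of_nat (Suc k)"]
      LIMSEQ_Suc[OF lim_1_over_n])
  then have "(\<lambda>k. coef (f k * g k) \<mu>) \<longlonglongrightarrow> coef ?G \<mu>" for \<mu>
    unfolding fg(3)[symmetric] H_def by (simp add: lookup_add)
  moreover have "?G \<noteq> 0"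
    using coef_irr_form[of d "mon3 d 0 0"] by auto
  ultimately obtain F K where FK: "is_form m F" "is_form n K" "?G = F * K"
    using form_products_closed[of m f n g ?G] fg(1,2) by blast
  show False
  proof (cases "m < 0 \<or> n < 0")
    case True
    then have "F = 0 \<or> K = 0" using is_form_neg FK by blast
    then show False using FK(3) \<open>?G \<noteq> 0\<close> by auto
  next
    case False
    then have "is_form (int (nat m)) F" "is_form (int (nat n)) K" "d = nat m + nat n"
      using FK mn by (auto simp: d_def nat_add_distrib)
    then show False using irr_form_not_product[of "nat m" "nat n" F K] False mn FK(3) by simp
  qed
qed

theorem theorem3p6:
  fixes a b c e d :: int
  assumes "homogeneous_mat a b c e"
    and "well_ordered_mat a b c e"
    and "d = a + e"
    and "d > 0"
  shows "general_form d (is_det_degmat a b c e) \<longleftrightarrow> (a \<in> {0, d} \<or> c \<ge> 0)"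
proof
  assume gen: "general_form d (is_det_degmat a b c e)"
  show "a \<in> {0, d} \<or> c \<ge> 0"
  proof (rule ccontr)
    assume contra: "\<not> (a \<in> {0, d} \<or> c \<ge> 0)"
    have "\<exists>f g. is_form a f \<and> is_form e g \<and> F = f * g" if "is_det_degmat a b c e F" for F
      using that contra is_form_neg[of c] unfolding is_det_degmat_def by fastforce
    then have "general_form (a + e) (\<lambda>F. \<exists>f g. is_form a f \<and> is_form e g \<and> F = f * g)"
      using gen assms(3) unfolding general_form_def by blast
    then show False using not_general_product assms contra by auto
  qed
next
  have ad: "a + e = b + c" using assms(1) by (simp add: homogeneous_mat_def)
  have one: "is_form 0 1"
    using is_form_single[of 0 0 1] mon3_in_monoms[of 0 0 0 0] by (simp add: mon3_0)
  assume "a \<in> {0, d} \<or> c \<ge> 0"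
  then consider "a = 0" | "e = 0" | "c \<ge> 0" using assms(3) by auto
  \<comment> \<open>If \<open>a\<close> or \<open>e\<close> is 0, a diagonal matrix with an entry 1
    represents every form, so the density hypothesis of \<open>general_form_det\<close> is
    immediate.\<close>
  then have "general_form (a + e) (is_det_degmat a b c e)"
  proof cases
    case 1
    have "is_det_degmat a b c e F" if "is_form (a + e) F" for F
      unfolding is_det_degmat_def
      by (rule exI[of _ 1], rule exI[of _ 0], rule exI[of _ 0], rule exI[of _ F])
        (use 1 that one in \<open>auto simp: is_form_0\<close>)
    then show ?thesis by (intro general_form_det ad) blast
  next
    case 2
    have "is_det_degmat a b c e F" if "is_form (a + e) F" for F
      unfolding is_det_degmat_def
      by (rule exI[of _ F], rule exI[of _ 0], rule exI[of _ 0], rule exI[of _ 1])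
        (use 2 that one in \<open>auto simp: is_form_0\<close>)
    then show ?thesis by (intro general_form_det ad) blast
  next
    case 3
    have le: "c \<le> a" "c \<le> e" using assms(2) by (auto simp: well_ordered_mat_def)
    have eqs: "int (nat a) = a" "int (nat e) = e" "int (nat c) = c" "a + e - c = b"
      using 3 le ad by auto
    show ?thesis
    proof (rule general_form_det[OF ad])
      fix P F assume P: "P \<in> poly_fun" and van: "\<And>G. is_det_degmat a b c e G \<Longrightarrow> P G = 0"
        and F: "is_form (a + e) F"
      have det: "P (f11 * f22 - f12 * f21) = 0"
        if "is_form a f11" "is_form b f12" "is_form c f21" "is_form e f22" for f11 f12 f21 f22
        by (rule van) (use that in \<open>unfold is_det_degmat_def, blast\<close>)
      show "P F = 0"
        by (rule det_image_dominant[of "nat c" "nat a" "nat e", OF _ _ P])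
          (use le 3 F det in \<open>simp_all add: eqs\<close>)
    qed
  qed
  then show "general_form d (is_det_degmat a b c e)" using assms(3) by simp
qed

end
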